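(* The left tail of $W$ satisfies $$-\log\mathbb P(W<x)\sim\tfrac12(\log x)^2\qquad\text{as } x\to0^+ .$$
   Context: Let $(\mathbf Z_n)_{n\ge 0}$ be the branching random walk on $\mathbb R_+^2$ started from a single particle at the origin, in which every particle of generation $n$ located at $y\in\mathbb R_+^2$ gives birth, independently of all other particles, to children located at $y+z$, where $z$ ranges over the atoms of an independent copy of a Poisson point process on $(0,\infty)^2$ whose intensity is Lebesgue measure $\mathrm dt\,\mathrm dx$; $\mathbf Z_n$ denotes the point measure of positions of generation $n$. Set $W_n=\int e^{-t-x}\,\mathbf Z_n(\mathrm dt,\mathrm dx)$; $(W_n)_{n\ge0}$ is a nonnegative martingale of mean $1$ converging almost surely and in $L^1$ to a limit $W$ with $\mathbb E W=1$. $f(x)\sim g(x)$ means $f(x)/g(x)\to 1$. *)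

theory Defs
  imports "HOL-Probability.Probability" "HOL-Library.Landau_Symbols"
begin

definition quadrant :: "(real \<times> real) set" where
  "quadrant = {0<..} \<times> {0<..}"

definition pcount :: "(nat \<Rightarrow> real \<times> real) \<Rightarrow> (real \<times> real) set \<Rightarrow> ennreal" where
  "pcount z A = emeasure (count_space UNIV) {i. z i \<in> A}"

text \<open>Z is (an enumeration of the atoms of) a Poisson point process on (0,\<infinity>)^2
  with intensity Lebesgue measure dt dx: the atoms are distinct and lie in the
  quadrant, counts in disjoint Borel sets of finite Lebesgue measure are independent,
  and the count in such a set A is Poisson with mean Leb(A).\<close>
definition poisson_pp :: "'a measure \<Rightarrow> ('a \<Rightarrow> nat \<Rightarrow> real \<times> real) \<Rightarrow> bool" where
  "poisson_pp M Z \<longleftrightarrow>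
     (\<forall>\<omega>\<in>space M. inj (Z \<omega>) \<and> range (Z \<omega>) \<subseteq> quadrant) \<and>
     (\<forall>i. (\<lambda>\<omega>. Z \<omega> i) \<in> borel_measurable M) \<and>
     (\<forall>A. A \<in> sets borel \<and> A \<subseteq> quadrant \<and> emeasure lborel A < \<infinity> \<longrightarrow>
        (\<forall>k::nat. measure M {\<omega>\<in>space M. pcount (Z \<omega>) A = of_nat k}
                   = exp (- measure lborel A) * measure lborel A ^ k / fact k)) \<and>
     (\<forall>(J::nat set) A. finite J \<longrightarrow> disjoint_family_on A J \<longrightarrow>
        (\<forall>j\<in>J. A j \<in> sets borel \<and> A j \<subseteq> quadrant \<and> emeasure lborel (A j) < \<infinity>) \<longrightarrow>
        prob_space.indep_vars M (\<lambda>_. borel) (\<lambda>j \<omega>. pcount (Z \<omega>) (A j)) J)"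

text \<open>Ulam--Harris labelling: particle v = [i_1,...,i_n] of generation n = length v
  is the i_n-th child of the i_(n-1)-th child ... of the root; \<xi> u \<omega> enumerates the
  displacements of the children of particle u.  Position of particle v:\<close>
definition brw_pos :: "(nat list \<Rightarrow> 'a \<Rightarrow> nat \<Rightarrow> real \<times> real) \<Rightarrow> nat list \<Rightarrow> 'a \<Rightarrow> real \<times> real" where
  "brw_pos \<xi> v \<omega> = (\<Sum>k<length v. \<xi> (take k v) \<omega> (v ! k))"

definition brw_W :: "(nat list \<Rightarrow> 'a \<Rightarrow> nat \<Rightarrow> real \<times> real) \<Rightarrow> nat \<Rightarrow> 'a \<Rightarrow> ennreal" where
  "brw_W \<xi> n \<omega> = (\<Sum>\<^sub>\<infinity> v\<in>{v. length v = n}.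
      ennreal (exp (- (fst (brw_pos \<xi> v \<omega>) + snd (brw_pos \<xi> v \<omega>)))))"

text \<open>The almost sure limit W (taken as liminf, which equals the limit a.s.).\<close>
definition brw_Wlim :: "(nat list \<Rightarrow> 'a \<Rightarrow> nat \<Rightarrow> real \<times> real) \<Rightarrow> 'a \<Rightarrow> ennreal" where
  "brw_Wlim \<xi> \<omega> = liminf (\<lambda>n. brw_W \<xi> n \<omega>)"

end

theory Submission
  imports Defs
begin

text \<open>
  Let \<open>s = t + x\<close> for an atom \<open>(t, x)\<close>. Splitting at the first generation gives
  \<open>W = (\<Sum>i. exp (- s\<^sub>i) * W\<^sub>i)\<close>, with \<open>W\<^sub>i\<close> the limits of the subtrees of the children of the root,
  and the number of children with \<open>s \<le> u\<close> is Poisson with mean \<open>u\<^sup>2 / 2\<close>.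

  Upper bound for \<open>- ln P(W < x)\<close>: with probability \<open>exp (- u\<^sup>2 / 2)\<close> no child has \<open>s \<le> u\<close>, and
  on this event \<open>W\<close> has conditional mean at most \<open>(u + 1) * exp (- u)\<close>. Markov's inequality with \<open>u\<close>
  slightly larger than \<open>- ln x\<close> gives the claim.

  Lower bound: if \<open>W < \<delta> * exp (- u)\<close> then \<open>W\<^sub>i < \<delta>\<close> for every child with \<open>s\<^sub>i \<le> u\<close>. If
  \<open>P(W < \<delta>) \<le> q\<close>, this has probability at most \<open>exp (- (1 - q) * u\<^sup>2 / 2)\<close>, the generating function of
  the Poisson law at \<open>q\<close>. A second moment estimate provides some such \<open>\<delta>\<close> and \<open>q < 1\<close>; a first
  application of the bound makes \<open>q\<close> arbitrarily small, and a second one gives the claim. All these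
  bounds hold uniformly over the branching random walks on the same probability space, so that the
  equality in law of \<open>W\<close> and \<open>W\<^sub>i\<close> is never needed.
\<close>

section \<open>Decomposition at the first generation\<close>

text \<open>A nonnegative infinite sum is the supremum of its finite partial sums, and a countable
  set is exhausted by an increasing sequence of finite sets, so monotone convergence identifies the
  two. Sums over particles thereby become integrals, open to Tonelli and changes of
  variables.\<close>

lemma infsum_ennreal_eq_nn_integral:
  fixes f :: "'a \<Rightarrow> ennreal"
  assumes "countable A"
  shows "infsum f A = (\<integral>\<^sup>+x. f x \<partial>count_space A)"
proof (rule antisym)
  show "infsum f A \<le> (\<integral>\<^sup>+x. f x \<partial>count_space A)"
    unfolding nonneg_infsum_complete[OF zero_le]
  proof (rule SUP_least, clarify)
    fix F assume F: "finite F" "F \<subseteq> A"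
    have "sum f F = (\<integral>\<^sup>+x. f x * indicator F x \<partial>count_space A)"
      using F by (subst nn_integral_count_space'[of F]) auto
    also have "\<dots> \<le> (\<integral>\<^sup>+x. f x \<partial>count_space A)"
      by (intro nn_integral_mono) (auto simp: indicator_def)
    finally show "sum f F \<le> (\<integral>\<^sup>+x. f x \<partial>count_space A)" .
  qed
next
  define B where "B n = {x\<in>A. to_nat_on A x < n}" for n
  have fin: "finite (B n)" for n
  proof (rule finite_imageD)
    show "finite (to_nat_on A ` B n)"
      by (rule finite_subset[of _ "{..<n}"]) (auto simp: B_def)
    show "inj_on (to_nat_on A) (B n)"
      by (rule inj_on_subset[OF inj_on_to_nat_on[OF assms]]) (auto simp: B_def)
  qed
  have "(\<integral>\<^sup>+x. f x \<partial>count_space A) = (\<integral>\<^sup>+x. (SUP n. f x * indicator (B n) x) \<partial>count_space A)"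
  proof (rule nn_integral_cong)
    fix x assume "x \<in> space (count_space A)"
    then have "x \<in> B (Suc (to_nat_on A x))" by (auto simp: B_def)
    then show "f x = (SUP n. f x * indicator (B n) x)"
      by (intro antisym SUP_least SUP_upper2[of "Suc (to_nat_on A x)"]) (auto simp: indicator_def)
  qed
  also have "\<dots> = (SUP n. \<integral>\<^sup>+x. f x * indicator (B n) x \<partial>count_space A)"
    by (rule nn_integral_monotone_convergence_SUP)
       (auto simp: incseq_def le_fun_def indicator_def B_def)
  also have "\<dots> \<le> infsum f A"
  proof (rule SUP_least)
    fix n
    have "(\<integral>\<^sup>+x. f x * indicator (B n) x \<partial>count_space A) = sum f (B n)"
      using fin[of n] by (subst nn_integral_count_space'[of "B n"]) (auto simp: B_def)
    also have "\<dots> \<le> infsum f A"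
      unfolding nonneg_infsum_complete[OF zero_le]
      using fin[of n] by (intro SUP_upper) (auto simp: B_def)
    finally show "(\<integral>\<^sup>+x. f x * indicator (B n) x \<partial>count_space A) \<le> infsum f A" .
  qed
  finally show "(\<integral>\<^sup>+x. f x \<partial>count_space A) \<le> infsum f A" .
qed

definition level :: "real \<times> real \<Rightarrow> real" where
  "level p = fst p + snd p"

text \<open>Prepending \<open>i\<close> to every label re-roots the Ulam-Harris tree at the
  \<open>i\<close>-th child of the root, on the same probability space.\<close>

definition subtree :: "nat \<Rightarrow> (nat list \<Rightarrow> 'b) \<Rightarrow> nat list \<Rightarrow> 'b" where
  "subtree i \<xi> v = \<xi> (i # v)"

lemma level_add [simp]: "level (p + q) = level p + level q"
  by (simp add: level_def)

lemma level_0 [simp]: "level 0 = 0"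
  by (simp add: level_def)

lemma level_measurable [measurable]: "level \<in> borel_measurable borel"
  unfolding level_def[abs_def] borel_prod[symmetric] by measurable

lemma brw_pos_Cons:
  "brw_pos \<xi> (i # v) \<omega> = \<xi> [] \<omega> i + brw_pos (subtree i \<xi>) v \<omega>"
  by (simp add: brw_pos_def subtree_def sum.lessThan_Suc_shift del: sum.lessThan_Suc)

lemma brw_W_nn_integral:
  "brw_W \<xi> n \<omega> = (\<integral>\<^sup>+v. ennreal (exp (- level (brw_pos \<xi> v \<omega>))) \<partial>count_space {v. length v = n})"
  unfolding brw_W_def level_def by (rule infsum_ennreal_eq_nn_integral) simp

lemma brw_W_0 [simp]: "brw_W \<xi> 0 \<omega> = 1"
proof -
  have "{v::nat list. length v = 0} = {[]}" by auto
  then show ?thesis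
    unfolding brw_W_nn_integral by (simp add: nn_integral_count_space_finite brw_pos_def)
qed

text \<open>The map \<open>(i, v) \<mapsto> i # v\<close> parametrises the labels of length
  \<open>Suc n\<close>, and Tonelli sums over \<open>v\<close> first. Splitting off the first
  generation rather than the last makes each factor the same functional of a shifted family, which
  all later recursions exploit.\<close>

lemma brw_W_Suc:
  "brw_W \<xi> (Suc n) \<omega> = (\<Sum>i. ennreal (exp (- level (\<xi> [] \<omega> i))) * brw_W (subtree i \<xi>) n \<omega>)"
proof -
  let ?f = "\<lambda>v. ennreal (exp (- level (brw_pos \<xi> v \<omega>)))"
  have bij: "bij_betw (\<lambda>(i, v). i # v) (UNIV \<times> {v::nat list. length v = n}) {v. length v = Suc n}"
    by (auto simp: bij_betw_def inj_on_def image_iff length_Suc_conv)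
  have "brw_W \<xi> (Suc n) \<omega> = (\<integral>\<^sup>+p. ?f (case p of (i, v) \<Rightarrow> i # v) \<partial>count_space (UNIV \<times> {v. length v = n}))"
    unfolding brw_W_nn_integral by (rule nn_integral_bij_count_space[OF bij, symmetric])
  also have "\<dots> = (\<integral>\<^sup>+p. ?f (fst p # snd p) * indicator {v. length v = n} (snd p) \<partial>count_space UNIV)"
    by (auto simp: nn_integral_count_space_indicator indicator_def case_prod_beta intro!: nn_integral_cong)
  also have "\<dots> = (\<integral>\<^sup>+i. \<integral>\<^sup>+v. ?f (i # v) * indicator {v. length v = n} v \<partial>count_space UNIV \<partial>count_space UNIV)"
    by (subst nn_integral_fst_count_space[symmetric]) simp
  also have "\<dots> = (\<integral>\<^sup>+i. \<integral>\<^sup>+v. ?f (i # v) \<partial>count_space {v. length v = n} \<partial>count_space UNIV)"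
    by (simp add: nn_integral_count_space_indicator)
  also have "\<dots> = (\<integral>\<^sup>+i. ennreal (exp (- level (\<xi> [] \<omega> i))) * brw_W (subtree i \<xi>) n \<omega> \<partial>count_space UNIV)"
    by (intro nn_integral_cong)
       (simp add: brw_pos_Cons brw_W_nn_integral exp_add[symmetric] ennreal_mult[symmetric]
          nn_integral_cmult[symmetric])
  finally show ?thesis by (simp add: nn_integral_count_space_nat)
qed

text \<open>This exhibits \<open>brw_W\<close> as one fixed functional of the whole family of
  displacements, the form in which independence of the family can be applied.\<close>

lemma brw_W_eq_coordinates:
  "brw_W \<xi> n \<omega> = brw_W (\<lambda>v c. c v) n (\<lambda>v. \<xi> v \<omega>)"
  by (simp add: brw_W_def brw_pos_def)

lemma brw_W_measurable:
  assumes "\<And>v i. (\<lambda>\<omega>. \<xi> v \<omega> i) \<in> borel_measurable M"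
  shows "brw_W \<xi> n \<in> borel_measurable M"
  using assms
proof (induction n arbitrary: \<xi>)
  case 0
  show ?case by (subst measurable_cong[OF brw_W_0]) simp
next
  case (Suc n)
  have [measurable]: "brw_W (subtree i \<xi>) n \<in> borel_measurable M" for i
    by (rule Suc.IH) (simp add: subtree_def Suc.prems)
  note Suc.prems[measurable]
  show ?case unfolding brw_W_Suc by measurable
qed

lemma brw_Wlim_measurable:
  assumes "\<And>v i. (\<lambda>\<omega>. \<xi> v \<omega> i) \<in> borel_measurable M"
  shows "brw_Wlim \<xi> \<in> borel_measurable M"
  unfolding brw_Wlim_def using brw_W_measurable[OF assms] by measurable

text \<open>One summand of the first-generation decomposition bounds each generation from below, and
  multiplication by a finite constant commutes with \<open>liminf\<close>. The one-sided bound
  avoids exchanging the limit with the infinite sum over children.\<close>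

lemma brw_Wlim_ge_child:
  "ennreal (exp (- level (\<xi> [] \<omega> i))) * brw_Wlim (subtree i \<xi>) \<omega> \<le> brw_Wlim \<xi> \<omega>"
proof -
  have "ennreal (exp (- level (\<xi> [] \<omega> i))) * brw_Wlim (subtree i \<xi>) \<omega>
    = liminf (\<lambda>n. ennreal (exp (- level (\<xi> [] \<omega> i))) * brw_W (subtree i \<xi>) n \<omega>)"
    unfolding brw_Wlim_def by (rule Liminf_compose_continuous_mono[symmetric])
       (auto intro!: ennreal_continuous_on_cmult continuous_on_id monoI mult_left_mono)
  also have "\<dots> \<le> liminf (\<lambda>n. brw_W \<xi> (Suc n) \<omega>)"
    by (intro Liminf_mono always_eventually allI)
       (auto simp: brw_W_Suc intro!: order_trans[OF _ sum_le_suminf[of _ "{i}"]])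
  also have "\<dots> = brw_Wlim \<xi> \<omega>"
    unfolding brw_Wlim_def using liminf_shift[of "\<lambda>n. brw_W \<xi> n \<omega>"] by simp
  finally show ?thesis .
qed

section \<open>The Poisson law and the triangle below an antidiagonal\<close>

definition corner :: "real \<Rightarrow> (real \<times> real) set" where
  "corner u = {p \<in> quadrant. level p \<le> u}"

lemma quadrant_borel [measurable]: "quadrant \<in> sets borel"
  unfolding quadrant_def by (simp add: open_Times borel_open)

lemma corner_borel [measurable]: "corner u \<in> sets borel"
proof -
  have "corner u = quadrant \<inter> level -` {..u} \<inter> space borel"
    by (auto simp: corner_def)
  then show ?thesis by simp
qed

lemma corner_subset_quadrant: "corner u \<subseteq> quadrant"
  by (auto simp: corner_def)

lemma corner_mono: "u \<le> v \<Longrightarrow> corner u \<subseteq> corner v"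
  by (auto simp: corner_def)

lemma corner_empty: "u \<le> 0 \<Longrightarrow> corner u = {}"
  by (auto simp: corner_def quadrant_def level_def)

lemma emeasure_corner:
  assumes "0 \<le> u"
  shows "emeasure lborel (corner u) = ennreal (u\<^sup>2 / 2)"
proof -
  have "corner u \<in> sets (lborel \<Otimes>\<^sub>M (lborel :: real measure))"
    unfolding lborel_prod by simp
  then have "emeasure lborel (corner u) = (\<integral>\<^sup>+x. emeasure lborel (Pair x -` corner u) \<partial>lborel)"
    by (subst lborel_prod[symmetric]) (rule lborel.emeasure_pair_measure_alt)
  also have "\<dots> = (\<integral>\<^sup>+x. ennreal (u - x) * indicator {0..u} x \<partial>lborel)"
  proof (rule nn_integral_cong_AE)
    \<comment> \<open>At \<open>x = 0\<close> the section of the open quadrant is empty although the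
      formula gives \<open>u\<close>; this single point is discarded as a null set.\<close>
    show "AE x in lborel. emeasure lborel (Pair x -` corner u) = ennreal (u - x) * indicator {0..u} x"
      using AE_lborel_singleton[of "0::real"]
    proof eventually_elim
      case (elim x)
      have "Pair x -` corner u = (if 0 < x then {0<..u - x} else {})"
        by (auto simp: corner_def quadrant_def level_def)
      then show ?case using elim by (auto simp: indicator_def)
    qed
  qed
  also have "\<dots> = ennreal ((u * u - u\<^sup>2 / 2) - (u * 0 - 0\<^sup>2 / 2))"
    by (rule nn_integral_FTC_Icc[where F="\<lambda>x. u * x - x\<^sup>2 / 2"])
       (auto intro!: derivative_eq_intros simp: assms)
  finally show ?thesis by (simp add: power2_eq_square)
qed

lemma measure_corner: "0 \<le> u \<Longrightarrow> measure lborel (corner u) = u\<^sup>2 / 2"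
  by (simp add: measure_def emeasure_corner)

section \<open>Counts of atoms and integrals against exponential weights\<close>

lemma pcount_eq_suminf: "pcount z A = (\<Sum>i. indicator A (z i))"
proof -
  have "pcount z A = (\<integral>\<^sup>+i. indicator {i. z i \<in> A} i \<partial>count_space UNIV)"
    by (simp add: pcount_def)
  also have "\<dots> = (\<Sum>i. indicator A (z i))"
    unfolding nn_integral_count_space_nat by (rule suminf_cong) (simp add: indicator_def)
  finally show ?thesis .
qed

lemma pcount_Un_disjoint: "A \<inter> B = {} \<Longrightarrow> pcount z (A \<union> B) = pcount z A + pcount z B"
  unfolding pcount_eq_suminf by (subst suminf_add) (auto simp: indicator_def intro!: suminf_cong)

lemma suminf_ennreal_head:
  fixes f :: "nat \<Rightarrow> ennreal"
  shows "(\<Sum>k. f k) = f 0 + (\<Sum>k. f (Suc k))"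
proof -
  have "f sums ((\<Sum>k. f (Suc k)) + f 0)"
    by (intro sums_Suc summable_sums) simp
  then show ?thesis by (simp add: sums_iff add.commute)
qed

text \<open>The factor \<open>(r\<^sup>2 - u\<^sup>2) / 2\<close> is the area of
  \<open>corner r - corner u\<close>. The antiderivative \<open>?F\<close> comes from integrating by
  parts twice and vanishes at infinity.\<close>

lemma nn_integral_exp_quadratic_tail:
  fixes a u :: real
  assumes "0 < a" "0 \<le> u"
  shows "(\<integral>\<^sup>+r. ennreal (a * exp (- a * r) * ((r\<^sup>2 - u\<^sup>2) / 2)) * indicator {u..} r \<partial>lborel)
    = ennreal (exp (- a * u) * (u / a + 1 / a\<^sup>2))"
proof -
  let ?F = "\<lambda>r. - exp (- a * r) * ((r\<^sup>2 - u\<^sup>2) / 2 + r / a + 1 / a\<^sup>2)"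
  have "(\<integral>\<^sup>+r. ennreal (a * exp (- a * r) * ((r\<^sup>2 - u\<^sup>2) / 2)) * indicator {u..} r \<partial>lborel)
    = ennreal (0 - ?F u)"
  proof (rule nn_integral_FTC_atLeast[where F="?F"])
    fix r assume "u \<le> r"
    then show "0 \<le> a * exp (- a * r) * ((r\<^sup>2 - u\<^sup>2) / 2)"
      using assms by (auto intro!: mult_nonneg_nonneg power_mono)
    show "(?F has_real_derivative a * exp (- a * r) * ((r\<^sup>2 - u\<^sup>2) / 2)) (at r)"
      using assms by (auto intro!: derivative_eq_intros simp: field_simps power2_eq_square)
  next
    show "(?F \<longlongrightarrow> 0) at_top" using assms by real_asymp
  qed measurable
  then show ?thesis by simp
qed

text \<open>Writing the exponential as a mixture of indicators of \<open>s \<le> r\<close> turns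
  exponential sums over atoms into integrals of counts in corners, and the Poisson assumption speaks
  about counts only.\<close>

lemma ennreal_exp_layer_cake:
  assumes "0 < a"
  shows "ennreal (exp (- a * s)) = (\<integral>\<^sup>+r. ennreal (a * exp (- a * r)) * indicator {s..} r \<partial>lborel)"
proof -
  have "(\<integral>\<^sup>+r. ennreal (a * exp (- a * r)) * indicator {s..} r \<partial>lborel) = ennreal (0 - (- exp (- a * s)))"
  proof (rule nn_integral_FTC_atLeast[where F="\<lambda>r. - exp (- a * r)"])
    fix r show "((\<lambda>r. - exp (- a * r)) has_real_derivative a * exp (- a * r)) (at r)"
      by (auto intro!: derivative_eq_intros)
    show "0 \<le> a * exp (- a * r)" using assms by simp
  next
    show "((\<lambda>r. - exp (- a * r)) \<longlongrightarrow> 0) at_top" using assms by real_asymp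
  qed measurable
  then show ?thesis by simp
qed

text \<open>The sets for which \<open>poisson_pp\<close> prescribes the law of the count.\<close>

definition finite_area :: "(real \<times> real) set \<Rightarrow> bool" where
  "finite_area A \<longleftrightarrow> A \<in> sets borel \<and> A \<subseteq> quadrant \<and> emeasure lborel A < \<infinity>"

lemma finite_area_borel: "finite_area A \<Longrightarrow> A \<in> sets borel"
  by (simp add: finite_area_def)

lemma finite_area_Diff: "finite_area A \<Longrightarrow> finite_area B \<Longrightarrow> finite_area (A - B)"
  unfolding finite_area_def by (auto intro: le_less_trans[OF emeasure_mono[of _ A]])

lemma finite_area_corner: "finite_area (corner u)"
  using corner_empty[of u] emeasure_corner[of u]
  by (cases "0 \<le> u") (auto simp: finite_area_def corner_subset_quadrant)

lemma finite_area_Int: "finite_area A \<Longrightarrow> finite_area B \<Longrightarrow> finite_area (A \<inter> B)"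
  using finite_area_Diff[of A "A - B"] finite_area_Diff[of A B] by (simp add: Diff_Diff_Int)

lemma measure_finite_area_split:
  assumes "finite_area A" "finite_area B"
  shows "measure lborel A = measure lborel (A \<inter> B) + measure lborel (A - B)"
proof -
  have "measure lborel ((A \<inter> B) \<union> (A - B)) = measure lborel (A \<inter> B) + measure lborel (A - B)"
    using finite_area_Int[OF assms] finite_area_Diff[OF assms]
    by (intro measure_Union) (auto simp: finite_area_def)
  then show ?thesis by (simp add: Un_Diff_Int Int_Diff_Un)
qed

section \<open>Moments of the Poisson distribution\<close>

lemma suminf_poisson:
  fixes m :: real
  assumes "0 \<le> m"
  shows "(\<Sum>k. ennreal (exp (- m) * m ^ k / fact k)) = 1"
proof -
  have "(\<lambda>k. exp (- m) * (m ^ k / fact k)) sums (exp (- m) * exp m)"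
    using exp_converges[of m] by (intro sums_mult) (simp add: divide_inverse_commute scaleR_conv_of_real mult.commute)
  then have "(\<Sum>k. ennreal (exp (- m) * (m ^ k / fact k))) = ennreal (exp (- m) * exp m)"
    using assms by (intro suminf_ennreal_eq) auto
  then show ?thesis by (simp add: exp_minus)
qed

text \<open>The size-biasing identity of the Poisson weights: multiplying the weight of
  \<open>k + 1\<close> by \<open>k + 1\<close> gives \<open>m\<close> times the weight of
  \<open>k\<close>. Applied once it yields the mean, and after shifting the index also the second
  moment.\<close>

lemma ennreal_poisson_Suc:
  fixes m :: real
  assumes "0 \<le> m"
  shows "of_nat (Suc k) * ennreal (exp (- m) * m ^ Suc k / fact (Suc k))
    = ennreal m * ennreal (exp (- m) * m ^ k / fact k)"
proof -
  have "real (Suc k) * (exp (- m) * m ^ Suc k / fact (Suc k)) = m * (exp (- m) * m ^ k / fact k)"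
    by (simp add: field_simps del: of_nat_Suc)
  then show ?thesis
    using assms by (simp add: ennreal_of_nat_eq_real_of_nat ennreal_mult[symmetric] del: of_nat_Suc fact_Suc power_Suc)
qed

lemma suminf_poisson_mean:
  fixes m :: real
  assumes "0 \<le> m"
  shows "(\<Sum>k. of_nat k * ennreal (exp (- m) * m ^ k / fact k)) = ennreal m"
proof -
  have "(\<Sum>k. of_nat k * ennreal (exp (- m) * m ^ k / fact k))
      = (\<Sum>k. of_nat (Suc k) * ennreal (exp (- m) * m ^ Suc k / fact (Suc k)))"
    using suminf_ennreal_head[of "\<lambda>k. of_nat k * ennreal (exp (- m) * m ^ k / fact k)"] by (simp del: of_nat_Suc fact_Suc power_Suc)
  then show ?thesis
    by (simp only: ennreal_poisson_Suc[OF assms] ennreal_suminf_cmult suminf_poisson[OF assms] mult_1_right)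
qed

lemma suminf_poisson_square:
  fixes m :: real
  assumes "0 \<le> m"
  shows "(\<Sum>k. (of_nat k)\<^sup>2 * ennreal (exp (- m) * m ^ k / fact k)) = ennreal m + (ennreal m)\<^sup>2"
proof -
  let ?p = "\<lambda>k. ennreal (exp (- m) * m ^ k / fact k)"
  have "(\<Sum>k. (of_nat k)\<^sup>2 * ?p k) = (\<Sum>k. (of_nat (Suc k))\<^sup>2 * ?p (Suc k))"
    using suminf_ennreal_head[of "\<lambda>k. (of_nat k)\<^sup>2 * ?p k"] by (simp del: of_nat_Suc fact_Suc power_Suc)
  also have "\<dots> = (\<Sum>k. ennreal m * (of_nat k * ?p k + ?p k))"
  proof (rule suminf_cong)
    fix k
    have "(of_nat (Suc k))\<^sup>2 * ?p (Suc k) = of_nat (Suc k) * (ennreal m * ?p k)"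
      by (simp only: power2_eq_square mult.assoc ennreal_poisson_Suc[OF assms])
    then show "(of_nat (Suc k))\<^sup>2 * ?p (Suc k) = ennreal m * (of_nat k * ?p k + ?p k)"
      by (simp add: algebra_simps)
  qed
  also have "\<dots> = ennreal m * ((\<Sum>k. of_nat k * ?p k) + (\<Sum>k. ?p k))"
    by (simp add: ennreal_suminf_cmult suminf_add[symmetric])
  also have "\<dots> = ennreal m * (ennreal m + 1)"
    using assms by (simp only: suminf_poisson_mean suminf_poisson)
  finally show ?thesis by (simp add: power2_eq_square algebra_simps)
qed

section \<open>Moments of Poisson processes\<close>

locale poisson_process = prob_space M for M :: "'a measure" +
  fixes Z :: "'a \<Rightarrow> nat \<Rightarrow> real \<times> real"
  assumes poisson: "poisson_pp M Z"
begin

lemma Z_in_quadrant: "\<omega> \<in> space M \<Longrightarrow> Z \<omega> i \<in> quadrant"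
  using poisson unfolding poisson_pp_def by auto

lemma Z_measurable [measurable]: "(\<lambda>\<omega>. Z \<omega> i) \<in> borel_measurable M"
  using poisson unfolding poisson_pp_def by auto

lemma in_corner_iff: "\<omega> \<in> space M \<Longrightarrow> Z \<omega> i \<in> corner u \<longleftrightarrow> level (Z \<omega> i) \<le> u"
  using Z_in_quadrant by (auto simp: corner_def)

lemma pcount_measurable [measurable]:
  assumes [measurable]: "A \<in> sets borel"
  shows "(\<lambda>\<omega>. pcount (Z \<omega>) A) \<in> borel_measurable M"
  unfolding pcount_eq_suminf by measurable

lemma prob_pcount:
  assumes "finite_area A"
  shows "prob {\<omega>\<in>space M. pcount (Z \<omega>) A = of_nat k}
    = exp (- measure lborel A) * measure lborel A ^ k / fact k"
  using poisson assms unfolding poisson_pp_def finite_area_def by blast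

lemma emeasure_pcount:
  assumes "finite_area A"
  shows "emeasure M {\<omega>\<in>space M. pcount (Z \<omega>) A = of_nat k}
    = ennreal (exp (- measure lborel A) * measure lborel A ^ k / fact k)"
  by (simp add: emeasure_eq_measure prob_pcount[OF assms])

text \<open>The Poisson probabilities of the finite values already sum to 1, so an infinite count
  has probability zero.\<close>

lemma AE_pcount_nat:
  assumes "finite_area A"
  shows "AE \<omega> in M. \<exists>k::nat. pcount (Z \<omega>) A = of_nat k"
proof -
  note [measurable] = finite_area_borel[OF assms]
  define m where "m = measure lborel A"
  let ?E = "\<lambda>k::nat. {\<omega>\<in>space M. pcount (Z \<omega>) A = of_nat k}"
  have "(\<lambda>k. prob (?E k)) sums prob (\<Union>k. ?E k)"
    by (rule finite_measure_UNION) (auto simp: disjoint_family_on_def)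
  moreover have "(\<lambda>k. exp (- m) * (m ^ k / fact k)) sums (exp (- m) * exp m)"
    using exp_converges[of m] by (intro sums_mult) (simp add: divide_inverse_commute scaleR_conv_of_real mult.commute)
  ultimately have "prob (\<Union>k. ?E k) = 1"
    by (simp add: prob_pcount[OF assms] m_def[symmetric] sums_iff exp_minus)
  then have "AE \<omega> in M. \<omega> \<in> (\<Union>k. ?E k)"
    by (intro AE_prob_1) simp
  then show ?thesis by eventually_elim auto
qed

text \<open>Almost surely the integrand is a countable sum of constants times indicators of the
  events that the count equals \<open>k\<close>; this reduces the integral to a series for an
  arbitrary function \<open>f\<close>.\<close>

lemma nn_integral_pcount:
  assumes "finite_area A"
  shows "(\<integral>\<^sup>+\<omega>. f (pcount (Z \<omega>) A) \<partial>M) =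
    (\<Sum>k. f (of_nat k) * ennreal (exp (- measure lborel A) * measure lborel A ^ k / fact k))"
proof -
  note [measurable] = finite_area_borel[OF assms]
  let ?E = "\<lambda>k::nat. {\<omega>\<in>space M. pcount (Z \<omega>) A = of_nat k}"
  have "(\<integral>\<^sup>+\<omega>. f (pcount (Z \<omega>) A) \<partial>M) = (\<integral>\<^sup>+\<omega>. (\<Sum>k. f (of_nat k) * indicator (?E k) \<omega>) \<partial>M)"
  proof (rule nn_integral_cong_AE)
    show "AE \<omega> in M. f (pcount (Z \<omega>) A) = (\<Sum>k. f (of_nat k) * indicator (?E k) \<omega>)"
      using AE_pcount_nat[OF assms] AE_space
    proof eventually_elim
      case (elim \<omega>)
      then obtain k :: nat where k: "pcount (Z \<omega>) A = of_nat k" by auto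
      have "(\<Sum>j. f (of_nat j) * indicator (?E j) \<omega>) = (\<Sum>j\<in>{k}. f (of_nat j) * indicator (?E j) \<omega>)"
        using k by (intro suminf_finite) (auto simp: indicator_def)
      then show ?case using k elim by simp
    qed
  qed
  also have "\<dots> = (\<Sum>k. f (of_nat k) * emeasure M (?E k))"
    by (subst nn_integral_suminf) (auto simp: nn_integral_cmult_indicator)
  finally show ?thesis by (simp add: emeasure_pcount[OF assms])
qed

lemma nn_integral_pcount_mean: "finite_area A \<Longrightarrow> (\<integral>\<^sup>+\<omega>. pcount (Z \<omega>) A \<partial>M) = ennreal (measure lborel A)"
  using nn_integral_pcount[of A "\<lambda>x. x"] by (simp add: suminf_poisson_mean)

lemma nn_integral_pcount_square:
  "finite_area A \<Longrightarrow> (\<integral>\<^sup>+\<omega>. (pcount (Z \<omega>) A)\<^sup>2 \<partial>M) = ennreal (measure lborel A) + (ennreal (measure lborel A))\<^sup>2"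
  using nn_integral_pcount[of A "\<lambda>x. x\<^sup>2"] by (simp add: suminf_poisson_square)

lemma nn_integral_pcount_indep:
  fixes f g :: "ennreal \<Rightarrow> ennreal"
  assumes "finite_area A" "finite_area B" "A \<inter> B = {}" and [measurable]: "f \<in> borel_measurable borel" "g \<in> borel_measurable borel"
  shows "(\<integral>\<^sup>+\<omega>. f (pcount (Z \<omega>) A) * g (pcount (Z \<omega>) B) \<partial>M)
    = (\<integral>\<^sup>+\<omega>. f (pcount (Z \<omega>) A) \<partial>M) * (\<integral>\<^sup>+\<omega>. g (pcount (Z \<omega>) B) \<partial>M)"
proof -
  define C where "C j = (if j = 0 then A else B)" for j :: nat
  have *: "indep_vars (\<lambda>_. borel) (\<lambda>j \<omega>. pcount (Z \<omega>) (C j)) {0, 1}"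
  proof -
    have "finite {0::nat, 1}" "disjoint_family_on C {0, 1}" "\<forall>j\<in>{0, 1}. finite_area (C j)"
      using assms(1-3) by (auto simp: disjoint_family_on_def C_def)
    then show ?thesis using poisson unfolding poisson_pp_def finite_area_def by blast
  qed
  have "indep_vars (\<lambda>_. borel) (\<lambda>j \<omega>. (if j = 0 then f else g) (pcount (Z \<omega>) (C j))) {0, 1}"
    by (rule indep_vars_compose2[OF *]) auto
  from indep_vars_nn_integral[OF _ this] show ?thesis
    by (simp add: C_def)
qed

text \<open>Both counts are split along \<open>A \<inter> B\<close>, \<open>A - B\<close> and
  \<open>B - A\<close>, whose counts are pairwise independent. Only the square of the count of the
  common piece exceeds the product of the means, by the variance, which is the area of
  \<open>A \<inter> B\<close>.\<close>

lemma nn_integral_pcount_mult: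
  assumes A: "finite_area A" and B: "finite_area B"
  shows "(\<integral>\<^sup>+\<omega>. pcount (Z \<omega>) A * pcount (Z \<omega>) B \<partial>M)
    = ennreal (measure lborel (A \<inter> B)) + ennreal (measure lborel A) * ennreal (measure lborel B)"
proof -
  note finite_area = finite_area_Int[OF A B] finite_area_Diff[OF A B] finite_area_Diff[OF B A]
  note [measurable] = finite_area[THEN finite_area_borel]
  let ?N = "\<lambda>A \<omega>. pcount (Z \<omega>) A" and ?m = "\<lambda>A. ennreal (measure lborel A)"
  have split: "?N A \<omega> = ?N (A \<inter> B) \<omega> + ?N (A - B) \<omega>" for A B \<omega>
    using pcount_Un_disjoint[of "A \<inter> B" "A - B" "Z \<omega>"] by (simp add: Int_Diff_Un Int_Diff_disjoint)
  have "(\<integral>\<^sup>+\<omega>. ?N A \<omega> * ?N B \<omega> \<partial>M)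
    = (\<integral>\<^sup>+\<omega>. (?N (A \<inter> B) \<omega>)\<^sup>2 + ?N (A \<inter> B) \<omega> * ?N (B - A) \<omega> + ?N (A - B) \<omega> * ?N (A \<inter> B) \<omega>
         + ?N (A - B) \<omega> * ?N (B - A) \<omega> \<partial>M)"
    by (intro nn_integral_cong, subst split[of _ A B], subst split[of _ B A])
       (simp add: algebra_simps power2_eq_square Int_commute)
  also have "\<dots> = (\<integral>\<^sup>+\<omega>. (?N (A \<inter> B) \<omega>)\<^sup>2 \<partial>M) + (\<integral>\<^sup>+\<omega>. ?N (A \<inter> B) \<omega> * ?N (B - A) \<omega> \<partial>M)
      + (\<integral>\<^sup>+\<omega>. ?N (A - B) \<omega> * ?N (A \<inter> B) \<omega> \<partial>M) + (\<integral>\<^sup>+\<omega>. ?N (A - B) \<omega> * ?N (B - A) \<omega> \<partial>M)"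
    by (simp add: nn_integral_add)
  also have "\<dots> = (?m (A \<inter> B) + (?m (A \<inter> B))\<^sup>2) + ?m (A \<inter> B) * ?m (B - A) + ?m (A - B) * ?m (A \<inter> B)
      + ?m (A - B) * ?m (B - A)"
  proof -
    have *: "(\<integral>\<^sup>+\<omega>. ?N C \<omega> * ?N D \<omega> \<partial>M) = ?m C * ?m D" if "finite_area C" "finite_area D" "C \<inter> D = {}" for C D
      using nn_integral_pcount_indep[OF that, of "\<lambda>x. x" "\<lambda>x. x"] that
      by (simp add: nn_integral_pcount_mean)
    show ?thesis
      using finite_area by (simp add: nn_integral_pcount_square, subst (1 2 3) *) auto
  qed
  also have "\<dots> = ?m (A \<inter> B) + (?m (A \<inter> B) + ?m (A - B)) * (?m (A \<inter> B) + ?m (B - A))"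
    by (simp add: algebra_simps power2_eq_square)
  also have "?m (A \<inter> B) + ?m (A - B) = ?m A"
    using measure_finite_area_split[OF A B] by simp
  also have "?m (A \<inter> B) + ?m (B - A) = ?m B"
    using measure_finite_area_split[OF B A] by (simp add: Int_commute)
  finally show ?thesis .
qed

text \<open>The product of the counts is a double sum over indices whose diagonal is the count of
  \<open>A \<inter> B\<close>. The mean of that diagonal is the finite area of
  \<open>A \<inter> B\<close>, so it cancels against the same term in the mixed second moment. In
  other words, the second factorial moment measure is a product of Lebesgue measures.\<close>

lemma nn_integral_pcount_offdiagonal:
  assumes A: "finite_area A" and B: "finite_area B"
  shows "(\<integral>\<^sup>+\<omega>. (\<Sum>i. \<Sum>j. indicator A (Z \<omega> i) * indicator B (Z \<omega> j) * of_bool (i \<noteq> j)) \<partial>M)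
    = ennreal (measure lborel A) * ennreal (measure lborel B)" (is "?K = _")
proof -
  note [measurable] = finite_area_borel[OF A] finite_area_borel[OF B] finite_area_borel[OF finite_area_Int[OF A B]]
  have "ennreal (measure lborel (A \<inter> B)) + ennreal (measure lborel A) * ennreal (measure lborel B)
    = (\<integral>\<^sup>+\<omega>. pcount (Z \<omega>) A * pcount (Z \<omega>) B \<partial>M)"
    using nn_integral_pcount_mult[OF A B] by simp
  also have "\<dots> = (\<integral>\<^sup>+\<omega>. pcount (Z \<omega>) (A \<inter> B)
      + (\<Sum>i. \<Sum>j. indicator A (Z \<omega> i) * indicator B (Z \<omega> j) * of_bool (i \<noteq> j)) \<partial>M)"
  proof (rule nn_integral_cong)
    fix \<omega>
    have "pcount (Z \<omega>) A * pcount (Z \<omega>) B = (\<Sum>i. \<Sum>j. indicator A (Z \<omega> i) * indicator B (Z \<omega> j))"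
      unfolding pcount_eq_suminf by (simp add: ennreal_suminf_cmult ennreal_suminf_multc)
    also have "\<dots> = (\<Sum>i. indicator (A \<inter> B) (Z \<omega> i)
        + (\<Sum>j. indicator A (Z \<omega> i) * indicator B (Z \<omega> j) * of_bool (i \<noteq> j)))"
    proof (rule suminf_cong)
      fix i
      have "(\<Sum>j. indicator A (Z \<omega> i) * indicator B (Z \<omega> j) :: ennreal)
        = (\<Sum>j. indicator A (Z \<omega> i) * indicator B (Z \<omega> j) * of_bool (j = i)
             + indicator A (Z \<omega> i) * indicator B (Z \<omega> j) * of_bool (i \<noteq> j))"
        by (intro suminf_cong) auto
      also have "\<dots> = (\<Sum>j. indicator A (Z \<omega> i) * indicator B (Z \<omega> j) * of_bool (j = i))
             + (\<Sum>j. indicator A (Z \<omega> i) * indicator B (Z \<omega> j) * of_bool (i \<noteq> j))"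
        by (rule suminf_add[symmetric]) auto
      also have "(\<Sum>j. indicator A (Z \<omega> i) * indicator B (Z \<omega> j) * of_bool (j = i) :: ennreal)
        = (\<Sum>j\<in>{i}. indicator A (Z \<omega> i) * indicator B (Z \<omega> j) * of_bool (j = i))"
        by (rule suminf_finite) auto
      finally show "(\<Sum>j. indicator A (Z \<omega> i) * indicator B (Z \<omega> j) :: ennreal)
        = indicator (A \<inter> B) (Z \<omega> i)
           + (\<Sum>j. indicator A (Z \<omega> i) * indicator B (Z \<omega> j) * of_bool (i \<noteq> j))"
        by (simp only: sum.insert_remove sum.empty finite.emptyI finite.insertI) (simp add: indicator_inter_arith)
    qed
    also have "\<dots> = pcount (Z \<omega>) (A \<inter> B)
        + (\<Sum>i. \<Sum>j. indicator A (Z \<omega> i) * indicator B (Z \<omega> j) * of_bool (i \<noteq> j))"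
      unfolding pcount_eq_suminf by (rule suminf_add[symmetric]) auto
    finally show "pcount (Z \<omega>) A * pcount (Z \<omega>) B = pcount (Z \<omega>) (A \<inter> B)
        + (\<Sum>i. \<Sum>j. indicator A (Z \<omega> i) * indicator B (Z \<omega> j) * of_bool (i \<noteq> j))" .
  qed
  also have "\<dots> = ennreal (measure lborel (A \<inter> B)) + ?K"
    by (subst nn_integral_add) (auto simp: nn_integral_pcount_mean finite_area_Int A B)
  finally show ?thesis by (simp add: ennreal_add_left_cancel)
qed

section \<open>Exponential sums over the atoms\<close>

lemma prob_void: "0 \<le> u \<Longrightarrow> emeasure M {\<omega>\<in>space M. pcount (Z \<omega>) (corner u) = 0} = ennreal (exp (- (u\<^sup>2 / 2)))"
  using emeasure_pcount[OF finite_area_corner, of u 0] by (simp add: measure_corner)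

lemma layer_cake_sum:
  assumes "\<omega> \<in> space M" "0 < a"
  shows "(\<Sum>i. ennreal (exp (- a * level (Z \<omega> i))))
    = (\<integral>\<^sup>+r. ennreal (a * exp (- a * r)) * pcount (Z \<omega>) (corner r) \<partial>lborel)"
proof -
  have "(\<Sum>i. ennreal (exp (- a * level (Z \<omega> i))))
    = (\<Sum>i. \<integral>\<^sup>+r. ennreal (a * exp (- a * r)) * indicator {level (Z \<omega> i)..} r \<partial>lborel)"
    by (simp only: ennreal_exp_layer_cake[OF assms(2)])
  also have "\<dots> = (\<integral>\<^sup>+r. (\<Sum>i. ennreal (a * exp (- a * r)) * indicator {level (Z \<omega> i)..} r) \<partial>lborel)"
    by (rule nn_integral_suminf[symmetric]) measurable
  also have "\<dots> = (\<integral>\<^sup>+r. ennreal (a * exp (- a * r)) * pcount (Z \<omega>) (corner r) \<partial>lborel)"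
    unfolding pcount_eq_suminf using in_corner_iff[OF assms(1)]
    by (simp add: ennreal_suminf_cmult indicator_def)
  finally show ?thesis .
qed

lemma in_corner_measurable [measurable]:
  "(\<lambda>x. indicator (corner (snd x)) (Z (fst x) i) :: ennreal) \<in> borel_measurable (M \<Otimes>\<^sub>M lborel)"
proof -
  have "(\<lambda>x. if level (Z (fst x) i) \<le> snd x then 1 else 0 :: ennreal) \<in> borel_measurable (M \<Otimes>\<^sub>M lborel)"
    by measurable
  also have "?this \<longleftrightarrow> ?thesis"
    by (intro measurable_cong) (auto simp: space_pair_measure in_corner_iff indicator_def)
  finally show ?thesis .
qed

lemma pcount_corner_measurable [measurable]:
  "(\<lambda>x. pcount (Z (fst x)) (corner (snd x))) \<in> borel_measurable (M \<Otimes>\<^sub>M lborel)"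
  unfolding pcount_eq_suminf by measurable

text \<open>The layer cake formula reduces the claim to counts in \<open>corner r\<close>. For
  \<open>r < u\<close> these vanish on the void event; for \<open>u \<le> r\<close> only atoms in
  \<open>corner r - corner u\<close> remain, and their number is independent of the void
  event.\<close>

lemma nn_integral_void_exp_sum:
  assumes "0 < a" "0 \<le> u"
  shows "(\<integral>\<^sup>+\<omega>. indicator {0} (pcount (Z \<omega>) (corner u)) * (\<Sum>i. ennreal (exp (- a * level (Z \<omega> i)))) \<partial>M)
    = ennreal (exp (- (u\<^sup>2 / 2))) * ennreal (exp (- a * u) * (u / a + 1 / a\<^sup>2))"
proof -
  interpret pair_sigma_finite M "lborel :: real measure" ..
  let ?v = "\<lambda>\<omega>. indicator {0} (pcount (Z \<omega>) (corner u)) :: ennreal"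
  let ?e = "\<lambda>r. ennreal (a * exp (- a * r))"
  have void: "(\<integral>\<^sup>+\<omega>. ?v \<omega> \<partial>M) = ennreal (exp (- (u\<^sup>2 / 2)))"
  proof -
    have "(\<integral>\<^sup>+\<omega>. ?v \<omega> \<partial>M) = (\<integral>\<^sup>+\<omega>. indicator {\<omega>\<in>space M. pcount (Z \<omega>) (corner u) = 0} \<omega> \<partial>M)"
      by (intro nn_integral_cong) (auto simp: indicator_def)
    then show ?thesis using prob_void[OF assms(2)] by simp
  qed
  have mean: "(\<integral>\<^sup>+\<omega>. ?v \<omega> * pcount (Z \<omega>) (corner r) \<partial>M)
    = ennreal (exp (- (u\<^sup>2 / 2))) * ennreal ((r\<^sup>2 - u\<^sup>2) / 2) * indicator {u..} r" for r
  proof (cases "u \<le> r")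
    case True
    have disj: "corner u \<inter> corner r = corner u" "corner r \<inter> corner u = corner u"
      using corner_mono[OF True] by auto
    have "?v \<omega> * pcount (Z \<omega>) (corner r) = ?v \<omega> * pcount (Z \<omega>) (corner r - corner u)" for \<omega>
      using pcount_Un_disjoint[of "corner u" "corner r - corner u" "Z \<omega>"] corner_mono[OF True]
      by (auto simp: indicator_def Un_absorb1)
    then have "(\<integral>\<^sup>+\<omega>. ?v \<omega> * pcount (Z \<omega>) (corner r) \<partial>M)
      = (\<integral>\<^sup>+\<omega>. ?v \<omega> * pcount (Z \<omega>) (corner r - corner u) \<partial>M)" by simp
    also have "\<dots> = (\<integral>\<^sup>+\<omega>. ?v \<omega> \<partial>M) * (\<integral>\<^sup>+\<omega>. pcount (Z \<omega>) (corner r - corner u) \<partial>M)"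
      by (rule nn_integral_pcount_indep) (auto intro: finite_area_corner finite_area_Diff)
    also have "(\<integral>\<^sup>+\<omega>. pcount (Z \<omega>) (corner r - corner u) \<partial>M) = ennreal ((r\<^sup>2 - u\<^sup>2) / 2)"
      using measure_finite_area_split[OF finite_area_corner finite_area_corner, of r u] True assms
      by (simp add: nn_integral_pcount_mean finite_area_corner finite_area_Diff measure_corner disj diff_divide_distrib)
    finally show ?thesis using True by (simp add: void)
  next
    case False
    have "?v \<omega> * pcount (Z \<omega>) (corner r) = 0" for \<omega>
    proof -
      have "pcount (Z \<omega>) (corner r) \<le> pcount (Z \<omega>) (corner u)"
        unfolding pcount_eq_suminf using corner_mono[of r u] False
        by (intro suminf_le) (auto simp: indicator_def)
      then show ?thesis by (auto simp: indicator_def)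
    qed
    then have "(\<integral>\<^sup>+\<omega>. ?v \<omega> * pcount (Z \<omega>) (corner r) \<partial>M) = (\<integral>\<^sup>+\<omega>. 0 \<partial>M)" by presburger
    then show ?thesis using False by simp
  qed
  have "(\<integral>\<^sup>+\<omega>. ?v \<omega> * (\<Sum>i. ennreal (exp (- a * level (Z \<omega> i)))) \<partial>M)
    = (\<integral>\<^sup>+\<omega>. \<integral>\<^sup>+r. ?e r * (?v \<omega> * pcount (Z \<omega>) (corner r)) \<partial>lborel \<partial>M)"
  proof (rule nn_integral_cong)
    fix \<omega> assume \<omega>: "\<omega> \<in> space M"
    have [measurable]: "(\<lambda>r. pcount (Z \<omega>) (corner r)) \<in> borel_measurable lborel"
      using measurable_compose[OF measurable_Pair1'[OF \<omega>] pcount_corner_measurable] by simp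
    show "?v \<omega> * (\<Sum>i. ennreal (exp (- a * level (Z \<omega> i))))
      = (\<integral>\<^sup>+r. ?e r * (?v \<omega> * pcount (Z \<omega>) (corner r)) \<partial>lborel)"
      unfolding layer_cake_sum[OF \<omega> assms(1)]
      by (subst nn_integral_cmult[symmetric]) (auto simp: mult_ac)
  qed
  also have "\<dots> = (\<integral>\<^sup>+r. \<integral>\<^sup>+\<omega>. ?e r * (?v \<omega> * pcount (Z \<omega>) (corner r)) \<partial>M \<partial>lborel)"
    by (rule Fubini'[symmetric]) (simp add: case_prod_beta)
  also have "\<dots> = (\<integral>\<^sup>+r. ennreal (exp (- (u\<^sup>2 / 2))) *
      (ennreal (a * exp (- a * r) * ((r\<^sup>2 - u\<^sup>2) / 2)) * indicator {u..} r) \<partial>lborel)"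
  proof (rule nn_integral_cong)
    fix r
    have "(\<integral>\<^sup>+\<omega>. ?e r * (?v \<omega> * pcount (Z \<omega>) (corner r)) \<partial>M)
      = ?e r * (\<integral>\<^sup>+\<omega>. ?v \<omega> * pcount (Z \<omega>) (corner r) \<partial>M)"
      by (rule nn_integral_cmult) measurable
    then show "(\<integral>\<^sup>+\<omega>. ?e r * (?v \<omega> * pcount (Z \<omega>) (corner r)) \<partial>M)
      = ennreal (exp (- (u\<^sup>2 / 2))) * (ennreal (a * exp (- a * r) * ((r\<^sup>2 - u\<^sup>2) / 2)) * indicator {u..} r)"
      unfolding mean using assms by (subst ennreal_mult'[of "a * exp (- a * r)"]) (simp_all only: mult_ac, simp)
  qed
  also have "\<dots> = ennreal (exp (- (u\<^sup>2 / 2))) * ennreal (exp (- a * u) * (u / a + 1 / a\<^sup>2))"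
    by (subst nn_integral_cmult) (simp_all only: nn_integral_exp_quadratic_tail[OF assms], measurable)
  finally show ?thesis .
qed

text \<open>At \<open>u = 0\<close> the corner is empty and the void event is the whole space, so
  the preceding formula becomes an unconditional mean.\<close>

lemma suminf_exp_mean:
  assumes "0 < a"
  shows "(\<Sum>i. \<integral>\<^sup>+\<omega>. ennreal (exp (- a * level (Z \<omega> i))) \<partial>M) = ennreal (1 / a\<^sup>2)"
proof -
  have "indicator {0} (pcount z (corner 0)) = (1 :: ennreal)" for z
    by (simp add: corner_empty pcount_def)
  note void = nn_integral_void_exp_sum[OF assms order_refl, unfolded this mult_1_left]
  have "(\<integral>\<^sup>+\<omega>. (\<Sum>i. ennreal (exp (- a * level (Z \<omega> i)))) \<partial>M) = ennreal (1 / a\<^sup>2)"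
    unfolding void by simp
  then show ?thesis
    by (subst nn_integral_suminf[symmetric]) measurable
qed

text \<open>Applying the layer cake formula to both exponentials leaves the off-diagonal count of
  two corners, whose mean factorises. The value is therefore the square of the integral of
  \<open>exp (- r) * r\<^sup>2 / 2\<close> over \<open>r \<ge> 0\<close>, which is 1.\<close>

lemma suminf_exp_offdiagonal:
  "(\<Sum>i. \<Sum>j. \<integral>\<^sup>+\<omega>. ennreal (exp (- level (Z \<omega> i))) * ennreal (exp (- level (Z \<omega> j))) * of_bool (i \<noteq> j) \<partial>M) = 1"
proof -
  interpret pair_sigma_finite M "lborel :: real measure" ..
  let ?e = "\<lambda>r. ennreal (exp (- r))" and ?t = "\<lambda>r \<omega> i. indicator (corner r) (Z \<omega> i) :: ennreal"
  let ?P = "\<lambda>i j r r'. \<integral>\<^sup>+\<omega>. ?t r \<omega> i * ?t r' \<omega> j * of_bool (i \<noteq> j) \<partial>M"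
  have *: "ennreal (exp (- level (Z \<omega> i))) = (\<integral>\<^sup>+r. ?e r * ?t r \<omega> i \<partial>lborel)" if "\<omega> \<in> space M" for \<omega> i
    using ennreal_exp_layer_cake[of 1 "level (Z \<omega> i)"] in_corner_iff[OF that]
    by (simp add: indicator_def)
  have [measurable]: "(\<lambda>r. ?t r \<omega> i) \<in> borel_measurable borel" if "\<omega> \<in> space M" for \<omega> i
    using measurable_compose[OF measurable_Pair1'[OF that] in_corner_measurable] by simp
  have eij: "(\<integral>\<^sup>+\<omega>. ennreal (exp (- level (Z \<omega> i))) * ennreal (exp (- level (Z \<omega> j))) * of_bool (i \<noteq> j) \<partial>M)
    = (\<integral>\<^sup>+r. \<integral>\<^sup>+r'. ?e r * ?e r' * ?P i j r r' \<partial>lborel \<partial>lborel)" for i j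
  proof -
    have "(\<integral>\<^sup>+\<omega>. ennreal (exp (- level (Z \<omega> i))) * ennreal (exp (- level (Z \<omega> j))) * of_bool (i \<noteq> j) \<partial>M)
      = (\<integral>\<^sup>+\<omega>. \<integral>\<^sup>+r. ?e r * ?t r \<omega> i * (ennreal (exp (- level (Z \<omega> j))) * of_bool (i \<noteq> j)) \<partial>lborel \<partial>M)"
      by (intro nn_integral_cong, subst nn_integral_multc) (simp_all add: *[of _ i] mult.assoc)
    also have "\<dots> = (\<integral>\<^sup>+r. \<integral>\<^sup>+\<omega>. ?e r * ?t r \<omega> i * (ennreal (exp (- level (Z \<omega> j))) * of_bool (i \<noteq> j)) \<partial>M \<partial>lborel)"
      by (rule Fubini'[symmetric]) (simp add: case_prod_beta)
    also have "\<dots> = (\<integral>\<^sup>+r. \<integral>\<^sup>+\<omega>. \<integral>\<^sup>+r'. ?e r * ?e r' * (?t r \<omega> i * ?t r' \<omega> j * of_bool (i \<noteq> j)) \<partial>lborel \<partial>M \<partial>lborel)"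
    proof (intro nn_integral_cong)
      fix r \<omega> assume "\<omega> \<in> space M"
      note [measurable] = \<open>\<And>\<omega> i. \<omega> \<in> space M \<Longrightarrow> (\<lambda>r. ?t r \<omega> i) \<in> borel_measurable borel\<close>[OF this]
      show "?e r * ?t r \<omega> i * (ennreal (exp (- level (Z \<omega> j))) * of_bool (i \<noteq> j))
        = (\<integral>\<^sup>+r'. ?e r * ?e r' * (?t r \<omega> i * ?t r' \<omega> j * of_bool (i \<noteq> j)) \<partial>lborel)"
      proof -
        have "?e r * ?t r \<omega> i * (ennreal (exp (- level (Z \<omega> j))) * of_bool (i \<noteq> j))
          = (?e r * ?t r \<omega> i * of_bool (i \<noteq> j)) * (\<integral>\<^sup>+r'. ?e r' * ?t r' \<omega> j \<partial>lborel)"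
          unfolding *[OF \<open>\<omega> \<in> space M\<close>, of j] by (simp only: mult_ac)
        also have "\<dots> = (\<integral>\<^sup>+r'. (?e r * ?t r \<omega> i * of_bool (i \<noteq> j)) * (?e r' * ?t r' \<omega> j) \<partial>lborel)"
          by (rule nn_integral_cmult[symmetric]) measurable
        finally show ?thesis by (simp only: mult_ac)
      qed
    qed
    also have "\<dots> = (\<integral>\<^sup>+r. \<integral>\<^sup>+r'. \<integral>\<^sup>+\<omega>. ?e r * ?e r' * (?t r \<omega> i * ?t r' \<omega> j * of_bool (i \<noteq> j)) \<partial>M \<partial>lborel \<partial>lborel)"
      by (intro nn_integral_cong Fubini'[symmetric]) (simp add: case_prod_beta)
    also have "\<dots> = (\<integral>\<^sup>+r. \<integral>\<^sup>+r'. ?e r * ?e r' * ?P i j r r' \<partial>lborel \<partial>lborel)"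
      by (intro nn_integral_cong nn_integral_cmult) measurable
    finally show ?thesis .
  qed
  \<comment> \<open>For \<open>i \<noteq> j\<close> this is the probability that the atoms
    \<open>i\<close> and \<open>j\<close> lie in the corners of sizes \<open>r\<close> and
    \<open>r'\<close>; its sum over both indices is the product of the two areas.\<close>
  define P where "P i j r r' = ?P i j r r'" for i j r r'
  have [measurable]: "(\<lambda>(r, r'). P i j r r') \<in> borel_measurable (lborel \<Otimes>\<^sub>M lborel)" for i j
  proof -
    have "(\<lambda>x. (snd x, fst (fst x))) \<in> measurable ((lborel \<Otimes>\<^sub>M lborel) \<Otimes>\<^sub>M M) (M \<Otimes>\<^sub>M (lborel :: real measure))"
      "(\<lambda>x. (snd x, snd (fst x))) \<in> measurable ((lborel \<Otimes>\<^sub>M lborel) \<Otimes>\<^sub>M M) (M \<Otimes>\<^sub>M (lborel :: real measure))"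
      by measurable
    note this[THEN measurable_compose[OF _ in_corner_measurable], simplified, measurable]
    show ?thesis by (simp add: case_prod_beta P_def)
  qed
  have P_sum: "(\<Sum>i. \<Sum>j. P i j r r') = ennreal (measure lborel (corner r)) * ennreal (measure lborel (corner r'))" for r r'
    using nn_integral_pcount_offdiagonal[OF finite_area_corner finite_area_corner, of r r']
    unfolding P_def by (simp add: nn_integral_suminf)
  define g where "g r = ?e r * ennreal (measure lborel (corner r))" for r
  \<comment> \<open>For negative \<open>r\<close> the corner is empty, which the indicator records.
    In this form the integral is the exponential tail formula with \<open>a = 1\<close> and
    \<open>u = 0\<close>.\<close>
  have g_eq: "g = (\<lambda>r. ennreal (1 * exp (- 1 * r) * ((r\<^sup>2 - 0\<^sup>2) / 2)) * indicator {0..} r)"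
  proof
    fix r
    show "g r = ennreal (1 * exp (- 1 * r) * ((r\<^sup>2 - 0\<^sup>2) / 2)) * indicator {0..} r"
      using corner_empty[of r]
      by (cases "0 \<le> r") (auto simp: g_def measure_corner ennreal_mult[symmetric] indicator_def)
  qed
  have g_integral: "(\<integral>\<^sup>+r. g r \<partial>lborel) = 1"
    unfolding g_eq by (subst nn_integral_exp_quadratic_tail) auto
  have [measurable]: "g \<in> borel_measurable lborel"
    unfolding g_eq by measurable
  have "(\<Sum>i. \<Sum>j. \<integral>\<^sup>+\<omega>. ennreal (exp (- level (Z \<omega> i))) * ennreal (exp (- level (Z \<omega> j))) * of_bool (i \<noteq> j) \<partial>M)
    = (\<Sum>i. \<Sum>j. \<integral>\<^sup>+r. \<integral>\<^sup>+r'. ?e r * ?e r' * P i j r r' \<partial>lborel \<partial>lborel)"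
    unfolding eij P_def ..
  also have "\<dots> = (\<integral>\<^sup>+r. \<integral>\<^sup>+r'. (\<Sum>i. \<Sum>j. ?e r * ?e r' * P i j r r') \<partial>lborel \<partial>lborel)"
    by (simp add: nn_integral_suminf del: ennreal_suminf_cmult)
  also have "\<dots> = (\<integral>\<^sup>+r. \<integral>\<^sup>+r'. g r * g r' \<partial>lborel \<partial>lborel)"
    by (simp add: ennreal_suminf_cmult P_sum g_def mult_ac)
  also have "\<dots> = (\<integral>\<^sup>+r. g r * (\<integral>\<^sup>+r'. g r' \<partial>lborel) \<partial>lborel)"
    by (intro nn_integral_cong nn_integral_cmult) measurable
  also have "\<dots> = 1"
    by (simp add: g_integral)
  finally show ?thesis .
qed

end

section \<open>Moments of the branching random walk\<close>

locale poisson_brw = prob_space M for M :: "'a measure" +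
  fixes \<xi> :: "nat list \<Rightarrow> 'a \<Rightarrow> nat \<Rightarrow> real \<times> real"
  assumes poisson_children: "\<And>v. poisson_pp M (\<xi> v)"
    and indep_children: "indep_vars (\<lambda>_. Pi\<^sub>M UNIV (\<lambda>_. borel)) \<xi> UNIV"
begin

sublocale root: poisson_process M "\<xi> []"
  by unfold_locales (rule poisson_children)

lemma children_measurable [measurable]: "(\<lambda>\<omega>. \<xi> v \<omega> i) \<in> borel_measurable M"
  using poisson_children unfolding poisson_pp_def by auto

lemma subtree_measurable [measurable]: "(\<lambda>\<omega>. subtree i \<xi> v \<omega> j) \<in> borel_measurable M"
  by (simp add: subtree_def children_measurable)

lemma brw_W_random_variable [measurable]: "brw_W \<xi> n \<in> borel_measurable M"
  by (rule brw_W_measurable) measurable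

lemma brw_Wlim_random_variable [measurable]: "brw_Wlim \<xi> \<in> borel_measurable M"
  by (rule brw_Wlim_measurable) measurable

text \<open>The labels \<open>i # v\<close> are distinct for distinct \<open>v\<close>, so the
  shifted family inherits joint independence. Inductions on the generation can thus generalise over
  \<xi> and apply their hypothesis to each subtree.\<close>

lemma poisson_brw_subtree: "poisson_brw M (subtree i \<xi>)"
proof
  show "poisson_pp M (subtree i \<xi> v)" for v
    by (simp add: subtree_def poisson_children)
  have "indep_vars (\<lambda>v. Pi\<^sub>M {i # v} (\<lambda>_. Pi\<^sub>M UNIV (\<lambda>_. borel)))
      (\<lambda>v \<omega>. restrict (\<lambda>w. \<xi> w \<omega>) {i # v}) UNIV"
    by (rule indep_vars_restrict[OF indep_children]) (auto simp: disjoint_family_on_def)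
  then have "indep_vars (\<lambda>_. Pi\<^sub>M UNIV (\<lambda>_. borel))
      (\<lambda>v \<omega>. (\<lambda>y. y (i # v)) (restrict (\<lambda>w. \<xi> w \<omega>) {i # v})) UNIV"
    by (rule indep_vars_compose2) (rule measurable_component_singleton, simp)
  then show "indep_vars (\<lambda>_. Pi\<^sub>M UNIV (\<lambda>_. borel)) (subtree i \<xi>) UNIV"
    by (simp add: subtree_def[abs_def])
qed

text \<open>Displacements attached to disjoint blocks of labels are independent, and the root and
  each subtree use their own block. General functionals and a finite index set cover first moments,
  second moments and the product over all children of low level.\<close>

lemma nn_integral_root_subtrees:
  fixes G :: "(nat \<Rightarrow> real \<times> real) \<Rightarrow> ennreal"
    and H :: "nat \<Rightarrow> (nat list \<Rightarrow> nat \<Rightarrow> real \<times> real) \<Rightarrow> ennreal"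
  assumes G: "G \<in> borel_measurable (Pi\<^sub>M UNIV (\<lambda>_. borel))"
    and H: "\<And>i. i \<in> I \<Longrightarrow> H i \<in> borel_measurable (Pi\<^sub>M UNIV (\<lambda>_. Pi\<^sub>M UNIV (\<lambda>_. borel)))"
    and I: "finite I"
  shows "(\<integral>\<^sup>+\<omega>. G (\<xi> [] \<omega>) * (\<Prod>i\<in>I. H i (\<lambda>v. subtree i \<xi> v \<omega>)) \<partial>M)
    = (\<integral>\<^sup>+\<omega>. G (\<xi> [] \<omega>) \<partial>M) * (\<Prod>i\<in>I. \<integral>\<^sup>+\<omega>. H i (\<lambda>v. subtree i \<xi> v \<omega>) \<partial>M)"
proof -
  \<comment> \<open>Block \<open>0\<close> holds the label of the root and block
    \<open>Suc i\<close> the labels at or below its child \<open>i\<close>.\<close>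
  define K :: "nat \<Rightarrow> nat list set" where "K j = (case j of 0 \<Rightarrow> {[]} | Suc i \<Rightarrow> range ((#) i))" for j
  define \<Phi> :: "nat \<Rightarrow> (nat list \<Rightarrow> nat \<Rightarrow> real \<times> real) \<Rightarrow> ennreal"
    where "\<Phi> j y = (case j of 0 \<Rightarrow> G (y []) | Suc i \<Rightarrow> H i (\<lambda>v. y (i # v)))" for j y
  let ?J = "insert 0 (Suc ` I)"
  let ?X = "\<lambda>j \<omega>. restrict (\<lambda>v. \<xi> v \<omega>) (K j)"
  have "indep_vars (\<lambda>j. Pi\<^sub>M (K j) (\<lambda>_. Pi\<^sub>M UNIV (\<lambda>_. borel))) ?X ?J"
    by (rule indep_vars_restrict[OF indep_children]) (auto simp: disjoint_family_on_def K_def)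
  moreover have "\<Phi> j \<in> borel_measurable (Pi\<^sub>M (K j) (\<lambda>_. Pi\<^sub>M UNIV (\<lambda>_. borel)))" if "j \<in> ?J" for j
  proof (cases j)
    case 0
    have "(\<lambda>y. y []) \<in> measurable (Pi\<^sub>M {[]} (\<lambda>_. Pi\<^sub>M UNIV (\<lambda>_. borel))) (Pi\<^sub>M UNIV (\<lambda>_::nat. borel :: (real \<times> real) measure))"
      by (rule measurable_component_singleton) simp
    from measurable_compose[OF this G] show ?thesis
      unfolding 0 by (simp add: \<Phi>_def[abs_def] K_def)
  next
    case (Suc i)
    have "(\<lambda>y v. y (i # v)) \<in> measurable (Pi\<^sub>M (range ((#) i)) (\<lambda>_. Pi\<^sub>M UNIV (\<lambda>_. borel)))
        (Pi\<^sub>M UNIV (\<lambda>_. Pi\<^sub>M UNIV (\<lambda>_::nat. borel :: (real \<times> real) measure)))"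
      by (rule measurable_abs_UNIV) (rule measurable_component_singleton, simp)
    from measurable_compose[OF this H[of i]] show ?thesis
      using that unfolding Suc by (simp add: \<Phi>_def[abs_def] K_def image_iff)
  qed
  ultimately have "indep_vars (\<lambda>_. borel) (\<lambda>j \<omega>. \<Phi> j (?X j \<omega>)) ?J"
    by (rule indep_vars_compose2)
  from indep_vars_nn_integral[OF _ this] I
  have "(\<integral>\<^sup>+\<omega>. (\<Prod>j\<in>?J. \<Phi> j (?X j \<omega>)) \<partial>M) = (\<Prod>j\<in>?J. \<integral>\<^sup>+\<omega>. \<Phi> j (?X j \<omega>) \<partial>M)"
    by simp
  moreover have "(\<Prod>j\<in>?J. f j) = f 0 * (\<Prod>i\<in>I. f (Suc i))" for f :: "nat \<Rightarrow> ennreal"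
    using I by (subst prod.insert) (auto simp: prod.reindex)
  ultimately show ?thesis
    by (simp add: \<Phi>_def K_def subtree_def)
qed

lemma brw_W_coordinates_measurable:
  "brw_W (\<lambda>v c. c v) n \<in> borel_measurable (Pi\<^sub>M UNIV (\<lambda>_. Pi\<^sub>M UNIV (\<lambda>_. borel)))"
proof (rule brw_W_measurable)
  fix v :: "nat list" and i :: nat
  have "(\<lambda>c. c v) \<in> measurable (Pi\<^sub>M UNIV (\<lambda>_. Pi\<^sub>M UNIV (\<lambda>_. borel)))
      (Pi\<^sub>M UNIV (\<lambda>_::nat. borel :: (real \<times> real) measure))"
    by (rule measurable_component_singleton) simp
  from measurable_compose[OF this, of "\<lambda>z. z i" borel]
  show "(\<lambda>c. c v i :: real \<times> real) \<in> borel_measurable (Pi\<^sub>M UNIV (\<lambda>_. Pi\<^sub>M UNIV (\<lambda>_. borel)))"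
    by (simp add: measurable_component_singleton)
qed

lemma nn_integral_root_subtree:
  assumes G: "G \<in> borel_measurable (Pi\<^sub>M UNIV (\<lambda>_. borel))"
  shows "(\<integral>\<^sup>+\<omega>. G (\<xi> [] \<omega>) * brw_W (subtree i \<xi>) n \<omega> \<partial>M)
    = (\<integral>\<^sup>+\<omega>. G (\<xi> [] \<omega>) \<partial>M) * (\<integral>\<^sup>+\<omega>. brw_W (subtree i \<xi>) n \<omega> \<partial>M)"
  using nn_integral_root_subtrees[OF G brw_W_coordinates_measurable, of "{i}" "\<lambda>_. n"]
  by (simp add: brw_W_eq_coordinates[of "subtree i \<xi>"])

lemma nn_integral_root_subtree2:
  assumes G: "G \<in> borel_measurable (Pi\<^sub>M UNIV (\<lambda>_. borel))"
  shows "(\<integral>\<^sup>+\<omega>. G (\<xi> [] \<omega>) * (brw_W (subtree i \<xi>) n \<omega> * brw_W (subtree i \<xi>) m \<omega>) \<partial>M)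
    = (\<integral>\<^sup>+\<omega>. G (\<xi> [] \<omega>) \<partial>M) * (\<integral>\<^sup>+\<omega>. brw_W (subtree i \<xi>) n \<omega> * brw_W (subtree i \<xi>) m \<omega> \<partial>M)"
proof -
  note [measurable] = brw_W_coordinates_measurable
  have "(\<lambda>c. brw_W (\<lambda>v c. c v) n c * brw_W (\<lambda>v c. c v) m c)
      \<in> borel_measurable (Pi\<^sub>M UNIV (\<lambda>_. Pi\<^sub>M UNIV (\<lambda>_. borel)))"
    by measurable
  from nn_integral_root_subtrees[OF G this, of "{i}"] show ?thesis
    by (simp add: brw_W_eq_coordinates[of "subtree i \<xi>"])
qed

lemma nn_integral_root_two_subtrees:
  assumes G: "G \<in> borel_measurable (Pi\<^sub>M UNIV (\<lambda>_. borel))" and "i \<noteq> j"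
  shows "(\<integral>\<^sup>+\<omega>. G (\<xi> [] \<omega>) * (brw_W (subtree i \<xi>) n \<omega> * brw_W (subtree j \<xi>) m \<omega>) \<partial>M)
    = (\<integral>\<^sup>+\<omega>. G (\<xi> [] \<omega>) \<partial>M) * ((\<integral>\<^sup>+\<omega>. brw_W (subtree i \<xi>) n \<omega> \<partial>M) * (\<integral>\<^sup>+\<omega>. brw_W (subtree j \<xi>) m \<omega> \<partial>M))"
  using nn_integral_root_subtrees[OF G brw_W_coordinates_measurable, of "{i, j}" "\<lambda>k. if k = i then n else m"] \<open>i \<noteq> j\<close>
  by (simp add: brw_W_eq_coordinates[of "subtree i \<xi>"] brw_W_eq_coordinates[of "subtree j \<xi>"])

end

text \<open>The void event concerns the root displacements alone, so each subtree may be replaced by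
  its mean 1, leaving the exponential sum over the atoms with \<open>a = 1\<close>. The value is the
  same for every \<open>n\<close>, hence also for the lower limit of these integrals.\<close>

lemma (in poisson_brw) nn_integral_void_brw_W_Suc:
  assumes "0 \<le> u" and mean: "\<And>i. (\<integral>\<^sup>+\<omega>. brw_W (subtree i \<xi>) n \<omega> \<partial>M) = 1"
  shows "(\<integral>\<^sup>+\<omega>. indicator {0} (pcount (\<xi> [] \<omega>) (corner u)) * brw_W \<xi> (Suc n) \<omega> \<partial>M)
    = ennreal (exp (- (u\<^sup>2 / 2))) * ennreal (exp (- u) * (u + 1))"
proof -
  let ?v = "\<lambda>z. indicator {0} (pcount z (corner u)) :: ennreal"
  let ?e = "\<lambda>z i. ennreal (exp (- level (z i)))"
  interpret sub: poisson_brw M "subtree i \<xi>" for i by (rule poisson_brw_subtree)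
  have [measurable]: "(\<lambda>z. pcount z (corner u)) \<in> borel_measurable (Pi\<^sub>M UNIV (\<lambda>_. borel))"
    unfolding pcount_eq_suminf by measurable
  have "(\<integral>\<^sup>+\<omega>. ?v (\<xi> [] \<omega>) * brw_W \<xi> (Suc n) \<omega> \<partial>M)
    = (\<integral>\<^sup>+\<omega>. (\<Sum>i. ?v (\<xi> [] \<omega>) * ?e (\<xi> [] \<omega>) i * brw_W (subtree i \<xi>) n \<omega>) \<partial>M)"
    by (simp only: brw_W_Suc ennreal_suminf_cmult mult.assoc)
  also have "\<dots> = (\<Sum>i. \<integral>\<^sup>+\<omega>. ?v (\<xi> [] \<omega>) * ?e (\<xi> [] \<omega>) i * brw_W (subtree i \<xi>) n \<omega> \<partial>M)"
    by (rule nn_integral_suminf) measurable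
  also have "\<dots> = (\<Sum>i. \<integral>\<^sup>+\<omega>. ?v (\<xi> [] \<omega>) * ?e (\<xi> [] \<omega>) i \<partial>M)"
    by (intro suminf_cong, subst nn_integral_root_subtree[where G = "\<lambda>z. ?v z * ?e z _"]) (measurable, simp add: mean)
  also have "\<dots> = (\<integral>\<^sup>+\<omega>. (\<Sum>i. ?v (\<xi> [] \<omega>) * ?e (\<xi> [] \<omega>) i) \<partial>M)"
    by (rule nn_integral_suminf[symmetric]) measurable
  also have "\<dots> = (\<integral>\<^sup>+\<omega>. ?v (\<xi> [] \<omega>) * (\<Sum>i. ennreal (exp (- 1 * level (\<xi> [] \<omega> i)))) \<partial>M)"
    by (simp only: ennreal_suminf_cmult mult_minus_left mult_1_left)
  also have "\<dots> = ennreal (exp (- (u\<^sup>2 / 2))) * ennreal (exp (- 1 * u) * (u / 1 + 1 / 1\<^sup>2))"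
    using assms by (intro root.nn_integral_void_exp_sum) auto
  finally show ?thesis by simp
qed

lemma nn_integral_brw_W:
  assumes "poisson_brw M \<xi>"
  shows "(\<integral>\<^sup>+\<omega>. brw_W \<xi> n \<omega> \<partial>M) = 1"
  using assms
proof (induction n arbitrary: \<xi>)
  case 0
  interpret poisson_brw M \<xi> by fact
  show ?case by (simp add: emeasure_space_1)
next
  case (Suc n)
  interpret poisson_brw M \<xi> by fact
  have 1: "indicator {0} (pcount z (corner 0)) = (1 :: ennreal)" for z
    by (simp add: corner_empty pcount_def)
  show ?case
    using nn_integral_void_brw_W_Suc[OF order_refl Suc.IH[OF poisson_brw_subtree]]
    unfolding 1 by simp
qed

text \<open>Expanding both factors over the children gives a double sum. The diagonal contributes
  \<open>c\<close> times the mean exponential sum with \<open>a = 2\<close>, that is 1/4; off the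
  diagonal the subtrees have mean 1 and the root weights sum to 1.\<close>

lemma (in poisson_brw) nn_integral_brw_W_Suc_mult:
  assumes c: "\<And>i. (\<integral>\<^sup>+\<omega>. brw_W (subtree i \<xi>) n \<omega> * brw_W (subtree i \<xi>) m \<omega> \<partial>M) = c"
  shows "(\<integral>\<^sup>+\<omega>. brw_W \<xi> (Suc n) \<omega> * brw_W \<xi> (Suc m) \<omega> \<partial>M) = ennreal (1 / 4) * c + 1"
proof -
  let ?e = "\<lambda>z i. ennreal (exp (- level (z i)))" and ?W = "\<lambda>i n. brw_W (subtree i \<xi>) n"
  interpret sub: poisson_brw M "subtree i \<xi>" for i by (rule poisson_brw_subtree)
  \<comment> \<open>The two \<open>of_bool\<close> factors merge the diagonal and off-diagonal cases
    into one formula that can be summed over \<open>j\<close>.\<close>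
  have summand: "(\<integral>\<^sup>+\<omega>. ?e (\<xi> [] \<omega>) i * ?e (\<xi> [] \<omega>) j * (?W i n \<omega> * ?W j m \<omega>) \<partial>M)
    = c * (\<integral>\<^sup>+\<omega>. ennreal (exp (- 2 * level (\<xi> [] \<omega> i))) \<partial>M) * of_bool (j = i) +
      (\<integral>\<^sup>+\<omega>. ?e (\<xi> [] \<omega>) i * ?e (\<xi> [] \<omega>) j * of_bool (i \<noteq> j) \<partial>M)" for i j
  proof (cases "i = j")
    case True
    have "?e z j * ?e z j = ennreal (exp (- 2 * level (z j)))" for z :: "nat \<Rightarrow> real \<times> real"
      by (simp add: ennreal_mult[symmetric] exp_add[symmetric])
    moreover have "(\<integral>\<^sup>+\<omega>. ?e (\<xi> [] \<omega>) j * ?e (\<xi> [] \<omega>) j * (?W j n \<omega> * ?W j m \<omega>) \<partial>M)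
      = (\<integral>\<^sup>+\<omega>. ?e (\<xi> [] \<omega>) j * ?e (\<xi> [] \<omega>) j \<partial>M) * c"
      unfolding c[symmetric, of j] by (rule nn_integral_root_subtree2[where G="\<lambda>z. ?e z j * ?e z j"]) measurable
    ultimately show ?thesis using True by (simp add: mult.commute)
  next
    case False
    have "(\<integral>\<^sup>+\<omega>. ?e (\<xi> [] \<omega>) i * ?e (\<xi> [] \<omega>) j * (?W i n \<omega> * ?W j m \<omega>) \<partial>M)
      = (\<integral>\<^sup>+\<omega>. ?e (\<xi> [] \<omega>) i * ?e (\<xi> [] \<omega>) j \<partial>M) * ((\<integral>\<^sup>+\<omega>. ?W i n \<omega> \<partial>M) * (\<integral>\<^sup>+\<omega>. ?W j m \<omega> \<partial>M))"
      by (rule nn_integral_root_two_subtrees[where G="\<lambda>z. ?e z i * ?e z j"]) (measurable, fact False)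
    then show ?thesis using False by (simp add: nn_integral_brw_W[OF poisson_brw_subtree])
  qed
  have "(\<integral>\<^sup>+\<omega>. brw_W \<xi> (Suc n) \<omega> * brw_W \<xi> (Suc m) \<omega> \<partial>M)
    = (\<integral>\<^sup>+\<omega>. (\<Sum>i. \<Sum>j. ?e (\<xi> [] \<omega>) i * ?e (\<xi> [] \<omega>) j * (?W i n \<omega> * ?W j m \<omega>)) \<partial>M)"
    unfolding brw_W_Suc by (simp only: ennreal_suminf_multc[symmetric] ennreal_suminf_cmult[symmetric] mult_ac)
  also have "\<dots> = (\<Sum>i. \<Sum>j. \<integral>\<^sup>+\<omega>. ?e (\<xi> [] \<omega>) i * ?e (\<xi> [] \<omega>) j * (?W i n \<omega> * ?W j m \<omega>) \<partial>M)"
    by (subst nn_integral_suminf, measurable) (intro suminf_cong nn_integral_suminf, measurable)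
  also have "\<dots> = (\<Sum>i. c * (\<integral>\<^sup>+\<omega>. ennreal (exp (- 2 * level (\<xi> [] \<omega> i))) \<partial>M) +
     (\<Sum>j. \<integral>\<^sup>+\<omega>. ?e (\<xi> [] \<omega>) i * ?e (\<xi> [] \<omega>) j * of_bool (i \<noteq> j) \<partial>M))"
  proof (rule suminf_cong)
    fix i
    let ?d = "c * (\<integral>\<^sup>+\<omega>. ennreal (exp (- 2 * level (\<xi> [] \<omega> i))) \<partial>M)"
    have "(\<Sum>j. ?d * of_bool (j = i)) = (\<Sum>j\<in>{i}. ?d * of_bool (j = i))"
      by (rule suminf_finite) auto
    then have "(\<Sum>j. ?d * of_bool (j = i)) = ?d" by (simp only: sum.insert_remove finite.emptyI sum.empty) simp
    then show "(\<Sum>j. \<integral>\<^sup>+\<omega>. ?e (\<xi> [] \<omega>) i * ?e (\<xi> [] \<omega>) j * (?W i n \<omega> * ?W j m \<omega>) \<partial>M)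
      = ?d + (\<Sum>j. \<integral>\<^sup>+\<omega>. ?e (\<xi> [] \<omega>) i * ?e (\<xi> [] \<omega>) j * of_bool (i \<noteq> j) \<partial>M)"
      unfolding summand by (subst suminf_add[symmetric]) simp_all
  qed
  also have "\<dots> = c * (\<Sum>i. \<integral>\<^sup>+\<omega>. ennreal (exp (- 2 * level (\<xi> [] \<omega> i))) \<partial>M) +
     (\<Sum>i. \<Sum>j. \<integral>\<^sup>+\<omega>. ?e (\<xi> [] \<omega>) i * ?e (\<xi> [] \<omega>) j * of_bool (i \<noteq> j) \<partial>M)"
    by (subst suminf_add[symmetric]) (simp_all only: ennreal_suminf_cmult summableI)
  also have "\<dots> = ennreal (1 / 4) * c + 1"
    unfolding root.suminf_exp_offdiagonal using root.suminf_exp_mean[of 2] by (simp add: mult.commute)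
  finally show ?thesis .
qed

text \<open>The recursion sends \<open>a\<close> to \<open>a / 4 + 1\<close>, with fixed point 4/3
  and initial value 1. That the result depends on the smaller generation only is the martingale
  property in second-moment form.\<close>

lemma nn_integral_brw_W_mult:
  assumes "poisson_brw M \<xi>"
  shows "(\<integral>\<^sup>+\<omega>. brw_W \<xi> n \<omega> * brw_W \<xi> (n + k) \<omega> \<partial>M) = ennreal (4 / 3 - (1 / 4) ^ n / 3)"
  using assms
proof (induction n arbitrary: \<xi>)
  case 0
  then show ?case by (simp add: nn_integral_brw_W)
next
  case (Suc n)
  interpret poisson_brw M \<xi> by fact
  have "(1 / 4 :: real) ^ n \<le> 1" by (rule power_le_one) auto
  then have "ennreal (1 / 4) * ennreal (4 / 3 - (1 / 4) ^ n / 3) + 1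
      = ennreal (1 / 4 * (4 / 3 - (1 / 4) ^ n / 3) + 1)"
    by (subst ennreal_mult[symmetric]) auto
  also have "1 / 4 * (4 / 3 - (1 / 4) ^ n / 3) + 1 = (4 / 3 - (1 / 4) ^ Suc n / 3 :: real)"
    by (simp add: field_simps)
  finally show ?case
    using nn_integral_brw_W_Suc_mult[OF Suc.IH[OF poisson_brw_subtree]] by simp
qed

section \<open>Nondegeneracy of the limit\<close>

text \<open>This is \<open>2 * d \<le> c * d\<^sup>2 + 1 / c\<close> for the positive part
  \<open>d\<close> of \<open>w - v\<close>, with the cross term of the square moved to the left
  because subtraction in \<open>ennreal\<close> is truncated.\<close>

lemma ennreal_decrement_bound:
  fixes v w :: ennreal and c :: real
  assumes "0 < c"
  shows "2 * (w - v) + 2 * ennreal c * (w * v) \<le> ennreal c * (w * w) + ennreal c * (v * v) + ennreal (1 / c)"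
proof (cases "w = top \<or> v = top")
  case True
  then show ?thesis using assms by (auto simp: ennreal_mult_top ennreal_top_mult)
next
  case False
  then obtain x y where xy: "w = ennreal x" "v = ennreal y" "0 \<le> x" "0 \<le> y"
    by (cases w; cases v) auto
  have "2 * max 0 (x - y) + 2 * c * (x * y) \<le> c * (x * x) + c * (y * y) + 1 / c"
  proof (cases "x \<le> y")
    case True
    have "0 \<le> c * (x - y)\<^sup>2 + 1 / c" using assms by simp
    then show ?thesis using True by (simp add: power2_eq_square algebra_simps)
  next
    case False
    have "0 \<le> (c * (x - y) - 1)\<^sup>2 / c" using assms by simp
    also have "(c * (x - y) - 1)\<^sup>2 / c = c * (x * x) + c * (y * y) + 1 / c - 2 * c * (x * y) - 2 * (x - y)"
      using assms by (simp add: power2_eq_square field_simps)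
    finally show ?thesis using False by simp
  qed
  then have "ennreal (2 * max 0 (x - y) + 2 * c * (x * y)) \<le> ennreal (c * (x * x) + c * (y * y) + 1 / c)"
    by (rule ennreal_leI)
  moreover have "w - v = ennreal (max 0 (x - y))"
    using xy by (auto simp: ennreal_minus max_def ennreal_neg)
  ultimately show ?thesis
    using assms xy by (simp add: ennreal_mult ennreal_mult' ennreal_numeral[symmetric] del: ennreal_numeral)
qed

context poisson_brw
begin

text \<open>The increments are orthogonal to the past, so their second moments are differences of second
  moments.\<close>
lemma nn_integral_brw_W_decrement:
  "(\<integral>\<^sup>+\<omega>. brw_W \<xi> n \<omega> - brw_W \<xi> (Suc n) \<omega> \<partial>M) \<le> ennreal (5 / 8 * (1 / 2) ^ n)" (is "?D \<le> _")
proof -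
  \<comment> \<open>This choice balances the two errors: \<open>c\<close> times the growth of the
    second moment is \<open>(1 / 2) ^ n / 4\<close>, while \<open>1 / c\<close> is
    \<open>(1 / 2) ^ n\<close>. Half of their sum is the claimed bound.\<close>
  define c where "c = (2 :: real) ^ n"
  define a where "a k = 4 / 3 - (1 / 4 :: real) ^ k / 3" for k :: nat
  have c: "0 < c" by (simp add: c_def)
  have a: "0 \<le> a k" for k
    using power_le_one[of "1 / 4 :: real" k] by (simp add: a_def)
  have sys: "poisson_brw M \<xi>" by unfold_locales
  let ?W = "brw_W \<xi>"
  have m: "(\<integral>\<^sup>+\<omega>. ?W k \<omega> * ?W k \<omega> \<partial>M) = ennreal (a k)" "(\<integral>\<^sup>+\<omega>. ?W k \<omega> * ?W (Suc k) \<omega> \<partial>M) = ennreal (a k)" for k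
    using nn_integral_brw_W_mult[OF sys, of k 0] nn_integral_brw_W_mult[OF sys, of k 1] by (simp_all add: a_def)
  have "2 * ?D + 2 * ennreal c * ennreal (a n)
    = (\<integral>\<^sup>+\<omega>. 2 * (?W n \<omega> - ?W (Suc n) \<omega>) + 2 * ennreal c * (?W n \<omega> * ?W (Suc n) \<omega>) \<partial>M)"
    by (simp add: nn_integral_add nn_integral_cmult m mult.assoc)
  also have "\<dots> \<le> (\<integral>\<^sup>+\<omega>. ennreal c * (?W n \<omega> * ?W n \<omega>) + ennreal c * (?W (Suc n) \<omega> * ?W (Suc n) \<omega>) + ennreal (1 / c) \<partial>M)"
    by (intro nn_integral_mono ennreal_decrement_bound c)
  also have "\<dots> = ennreal c * ennreal (a n) + ennreal c * ennreal (a (Suc n)) + ennreal (1 / c)"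
    by (simp add: nn_integral_add nn_integral_cmult m emeasure_space_1)
  also have "\<dots> = ennreal (c * a n + c * a (Suc n) + 1 / c)"
    using c a by (simp add: ennreal_mult)
  finally have le: "2 * ?D + 2 * ennreal c * ennreal (a n) \<le> ennreal (c * a n + c * a (Suc n) + 1 / c)" .
  \<comment> \<open>Finiteness allows the inequality to be read in the reals, where the common terms
    can be subtracted.\<close>
  then have "?D \<noteq> top" by (auto simp: ennreal_mult_top top_unique)
  then obtain d where d: "?D = ennreal d" "0 \<le> d" by (cases ?D) auto
  have "2 * ?D + 2 * ennreal c * ennreal (a n) = ennreal (2 * d + 2 * c * a n)"
    unfolding d(1) using c a d(2)
    by (simp add: ennreal_mult ennreal_mult' ennreal_numeral[symmetric] del: ennreal_numeral)
  with le have "ennreal (2 * d + 2 * c * a n) \<le> ennreal (c * a n + c * a (Suc n) + 1 / c)"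
    by simp
  then have "2 * d + 2 * c * a n \<le> c * a n + c * a (Suc n) + 1 / c"
    by (rule ennreal_le_iff[THEN iffD1, rotated])
       (intro add_nonneg_nonneg mult_nonneg_nonneg a less_imp_le[OF c], simp add: less_imp_le[OF c])
  moreover have "c * a (Suc n) - c * a n = (1 / 2) ^ n / 4" "1 / c = (1 / 2) ^ n"
  proof -
    have "(1 / 4 :: real) ^ n = (1 / 2) ^ n * (1 / 2) ^ n" "c * (1 / 2) ^ n = 1"
      by (simp_all add: power_mult_distrib[symmetric] c_def)
    then have "c * (1 / 4 :: real) ^ n = (1 / 2) ^ n" by simp
    then show "c * a (Suc n) - c * a n = (1 / 2) ^ n / 4"
      by (simp add: a_def algebra_simps)
    show "1 / c = (1 / 2) ^ n" by (simp add: c_def power_divide)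
  qed
  ultimately have "d \<le> 5 / 8 * (1 / 2) ^ n" by linarith
  then show ?thesis unfolding d(1) by (rule ennreal_leI)
qed

text \<open>Telescoping with truncated differences bounds the total descent after generation
  \<open>m\<close> by the sum of the decrements. This controls the lower limit without a martingale
  convergence theorem. If the sum is infinite the claim is trivial; otherwise it can be
  subtracted.\<close>

lemma brw_W_le_brw_Wlim: "brw_W \<xi> m \<omega> \<le> brw_Wlim \<xi> \<omega> + (\<Sum>k. brw_W \<xi> (m + k) \<omega> - brw_W \<xi> (Suc (m + k)) \<omega>)"
proof -
  let ?S = "\<Sum>k. brw_W \<xi> (m + k) \<omega> - brw_W \<xi> (Suc (m + k)) \<omega>"
  have "brw_W \<xi> m \<omega> \<le> brw_W \<xi> (m + n) \<omega> + (\<Sum>k<n. brw_W \<xi> (m + k) \<omega> - brw_W \<xi> (Suc (m + k)) \<omega>)" for n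
  proof (induction n)
    case (Suc n)
    have "brw_W \<xi> (m + n) \<omega> \<le> brw_W \<xi> (Suc (m + n)) \<omega> + (brw_W \<xi> (m + n) \<omega> - brw_W \<xi> (Suc (m + n)) \<omega>)"
      using ennreal_minus_le_iff by blast
    then have "brw_W \<xi> m \<omega> \<le> (brw_W \<xi> (Suc (m + n)) \<omega> + (brw_W \<xi> (m + n) \<omega> - brw_W \<xi> (Suc (m + n)) \<omega>))
        + (\<Sum>k<n. brw_W \<xi> (m + k) \<omega> - brw_W \<xi> (Suc (m + k)) \<omega>)"
      using Suc.IH by (meson add_right_mono order_trans)
    then show ?case by (simp add: add_ac)
  qed simp
  then have "brw_W \<xi> m \<omega> \<le> brw_W \<xi> (m + n) \<omega> + ?S" for n
    by (rule order_trans[of _ "_ + sum _ {..<n}"]) (intro add_left_mono sum_le_suminf, auto)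
  then have le: "brw_W \<xi> m \<omega> \<le> ?S + brw_W \<xi> (m + n) \<omega>" for n
    by (subst add.commute)
  show ?thesis
  proof (cases "?S = top")
    case False
    have "brw_W \<xi> m \<omega> - ?S \<le> brw_W \<xi> (m + n) \<omega>" for n
      using le[of n] False by (simp add: ennreal_minus_le_iff)
    then have "eventually (\<lambda>n. brw_W \<xi> m \<omega> - ?S \<le> brw_W \<xi> n \<omega>) sequentially"
      unfolding eventually_sequentially by (metis le_Suc_ex)
    then have "brw_W \<xi> m \<omega> - ?S \<le> brw_Wlim \<xi> \<omega>"
      unfolding brw_Wlim_def by (rule Liminf_bounded)
    then show ?thesis by (simp add: ennreal_minus_le_iff add.commute)
  qed simp
qed

lemma nn_integral_brw_Wlim_ge: "ennreal (11 / 16) \<le> (\<integral>\<^sup>+\<omega>. brw_Wlim \<xi> \<omega> \<partial>M)"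
proof -
  have sys: "poisson_brw M \<xi>" by unfold_locales
  \<comment> \<open>Starting from generation 0 the decrement bounds would sum to 5/4, which is more
    than the mean 1. From generation 2 on they sum to 5/16, leaving 11/16.\<close>
  let ?D = "\<lambda>k \<omega>. brw_W \<xi> (2 + k) \<omega> - brw_W \<xi> (Suc (2 + k)) \<omega>"
  have "1 = (\<integral>\<^sup>+\<omega>. brw_W \<xi> 2 \<omega> \<partial>M)" by (simp add: nn_integral_brw_W[OF sys])
  also have "\<dots> \<le> (\<integral>\<^sup>+\<omega>. brw_Wlim \<xi> \<omega> + (\<Sum>k. ?D k \<omega>) \<partial>M)"
    by (intro nn_integral_mono brw_W_le_brw_Wlim)
  also have "\<dots> = (\<integral>\<^sup>+\<omega>. brw_Wlim \<xi> \<omega> \<partial>M) + (\<integral>\<^sup>+\<omega>. (\<Sum>k. ?D k \<omega>) \<partial>M)"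
    by (rule nn_integral_add) measurable
  also have "(\<integral>\<^sup>+\<omega>. (\<Sum>k. ?D k \<omega>) \<partial>M) = (\<Sum>k. \<integral>\<^sup>+\<omega>. ?D k \<omega> \<partial>M)"
    by (rule nn_integral_suminf) measurable
  also have "(\<Sum>k. \<integral>\<^sup>+\<omega>. ?D k \<omega> \<partial>M) \<le> (\<Sum>k. ennreal (5 / 8 * (1 / 2) ^ (2 + k)))"
    by (intro suminf_le nn_integral_brw_W_decrement) auto
  also have "(\<Sum>k. ennreal (5 / 8 * (1 / 2) ^ (2 + k))) = ennreal (5 / 16)"
  proof (rule suminf_ennreal_eq)
    have "(\<lambda>k. 5 / 32 * (1 / 2) ^ k) sums (5 / 32 * (1 / (1 - 1 / 2 :: real)))"
      by (intro sums_mult geometric_sums) simp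
    then show "(\<lambda>k. 5 / 8 * (1 / 2) ^ (2 + k)) sums (5 / 16 :: real)"
      by (simp add: power_add power2_eq_square)
  qed simp
  finally have le: "1 \<le> (\<integral>\<^sup>+\<omega>. brw_Wlim \<xi> \<omega> \<partial>M) + ennreal (5 / 16)"
    by (simp add: add_left_mono)
  have "ennreal (11 / 16) = 1 - ennreal (5 / 16)"
    by (simp add: ennreal_minus ennreal_1[symmetric] del: ennreal_1)
  also have "\<dots> \<le> (\<integral>\<^sup>+\<omega>. brw_Wlim \<xi> \<omega> \<partial>M)"
    using le by (simp add: ennreal_minus_le_iff add.commute)
  finally show ?thesis .
qed

text \<open>Squaring is continuous and increasing, so it commutes with \<open>liminf\<close>;
  Fatou's lemma then passes on the uniform bound 4/3 of the second moments.\<close>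

lemma nn_integral_brw_Wlim_square: "(\<integral>\<^sup>+\<omega>. brw_Wlim \<xi> \<omega> * brw_Wlim \<xi> \<omega> \<partial>M) \<le> ennreal (4 / 3)"
proof -
  have sys: "poisson_brw M \<xi>" by unfold_locales
  have cont: "continuous_on UNIV (\<lambda>x::ennreal. x * x)"
    unfolding continuous_on_def by (auto intro!: tendsto_mult_ennreal tendsto_ident_at)
  have "brw_Wlim \<xi> \<omega> * brw_Wlim \<xi> \<omega> = liminf (\<lambda>n. brw_W \<xi> n \<omega> * brw_W \<xi> n \<omega>)" for \<omega>
    unfolding brw_Wlim_def
    by (rule Liminf_compose_continuous_mono[OF cont, symmetric]) (simp_all add: mono_def mult_mono)
  then have "(\<integral>\<^sup>+\<omega>. brw_Wlim \<xi> \<omega> * brw_Wlim \<xi> \<omega> \<partial>M) = (\<integral>\<^sup>+\<omega>. liminf (\<lambda>n. brw_W \<xi> n \<omega> * brw_W \<xi> n \<omega>) \<partial>M)"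
    by simp
  also have "\<dots> \<le> liminf (\<lambda>n. \<integral>\<^sup>+\<omega>. brw_W \<xi> n \<omega> * brw_W \<xi> n \<omega> \<partial>M)"
    by (rule nn_integral_liminf) measurable
  also have "\<dots> \<le> ennreal (4 / 3)"
    using nn_integral_brw_W_mult[OF sys, of _ 0]
    by (intro Liminf_le always_eventually allI) (auto intro!: ennreal_leI)
  finally show ?thesis .
qed

text \<open>A second moment argument of Paley-Zygmund type: a mean of at least 11/16 and a second
  moment of at most 4/3 prevent the mass from concentrating near zero.\<close>

lemma prob_brw_Wlim_small: "prob {\<omega>\<in>space M. brw_Wlim \<xi> \<omega> < ennreal (1 / 8)} \<le> 31 / 32"
proof -
  let ?W = "brw_Wlim \<xi>" and ?B = "{\<omega>\<in>space M. ennreal (1 / 8) \<le> brw_Wlim \<xi> \<omega>}"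
  \<comment> \<open>The three terms dominate \<open>w\<close> on the ranges below 1/8, between 1/8
    and 8, and above 8 respectively.\<close>
  have pointwise: "w \<le> ennreal (1 / 8) + ennreal 8 * indicator {ennreal (1 / 8)..} w + ennreal (1 / 8) * (w * w)" for w :: ennreal
  proof (cases w)
    case (real x)
    have "x \<le> 1 / 8 + 8 * indicator {1 / 8..} x + 1 / 8 * (x * x)"
    proof (cases "8 \<le> x")
      case True
      then have "8 * x \<le> x * x" using real by (intro mult_right_mono) auto
      then show ?thesis by (auto simp: indicator_def)
    qed (use real in \<open>auto simp: indicator_def add_increasing2\<close>)
    then have "ennreal x \<le> ennreal (1 / 8 + 8 * indicator {1 / 8..} x + 1 / 8 * (x * x))"
      by (rule ennreal_leI)
    also have "\<dots> = ennreal (1 / 8) + ennreal 8 * indicator {1 / 8..} x + ennreal (1 / 8) * (ennreal x * ennreal x)"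
      using real by (cases "1 / 8 \<le> x")
        (simp_all add: ennreal_mult[symmetric] ennreal_plus[symmetric] ennreal_numeral[symmetric]
          del: ennreal_plus ennreal_numeral)
    also have "indicator {1 / 8..} x = (indicator {ennreal (1 / 8)..} (ennreal x) :: ennreal)"
      using real by (auto simp: indicator_def)
    finally show ?thesis using real by simp
  qed (simp add: ennreal_mult_top)
  have "ennreal (11 / 16) \<le> (\<integral>\<^sup>+\<omega>. ?W \<omega> \<partial>M)"
    by (rule nn_integral_brw_Wlim_ge)
  also have "\<dots> \<le> (\<integral>\<^sup>+\<omega>. ennreal (1 / 8) + ennreal 8 * indicator ?B \<omega> + ennreal (1 / 8) * (?W \<omega> * ?W \<omega>) \<partial>M)"
  proof (rule nn_integral_mono)
    fix \<omega> assume "\<omega> \<in> space M"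
    then have "indicator ?B \<omega> = (indicator {ennreal (1 / 8)..} (?W \<omega>) :: ennreal)"
      by (simp add: indicator_def)
    then show "?W \<omega> \<le> ennreal (1 / 8) + ennreal 8 * indicator ?B \<omega> + ennreal (1 / 8) * (?W \<omega> * ?W \<omega>)"
      by (simp only: pointwise)
  qed
  also have "\<dots> = ennreal (1 / 8) + ennreal 8 * emeasure M ?B + ennreal (1 / 8) * (\<integral>\<^sup>+\<omega>. ?W \<omega> * ?W \<omega> \<partial>M)"
    by (simp add: nn_integral_add nn_integral_cmult emeasure_space_1)
  also have "\<dots> \<le> ennreal (1 / 8) + ennreal 8 * emeasure M ?B + ennreal (1 / 8) * ennreal (4 / 3)"
    by (intro add_left_mono mult_left_mono nn_integral_brw_Wlim_square) simp
  also have "\<dots> = ennreal (1 / 8 + 8 * prob ?B + 1 / 8 * (4 / 3))"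
    by (simp add: emeasure_eq_measure ennreal_mult[symmetric] ennreal_plus[symmetric]
        ennreal_numeral[symmetric] del: ennreal_plus ennreal_numeral)
  \<comment> \<open>This forces \<open>prob ?B\<close> to be at least 19/384, which exceeds
    1/32.\<close>
  finally have "11 / 16 \<le> 1 / 8 + 8 * prob ?B + 1 / 8 * (4 / 3)"
    by (subst (asm) ennreal_le_iff) auto
  moreover have "prob {\<omega>\<in>space M. ?W \<omega> < ennreal (1 / 8)} = 1 - prob ?B"
    using prob_compl[of ?B] by (simp add: set_diff_eq not_le Collect_conj_eq[symmetric] cong: conj_cong)
  ultimately show ?thesis by simp
qed

end

section \<open>Small ball estimates\<close>

lemma prod_ennreal_le_power:
  fixes f :: "'a \<Rightarrow> ennreal"
  assumes "finite J" "\<And>i. i \<in> J \<Longrightarrow> f i \<le> q"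
  shows "prod f J \<le> q ^ card J"
  using assms by (induction J) (auto intro: mult_mono)

context poisson_brw
begin

lemma brw_Wlim_coordinates_measurable:
  "brw_Wlim (\<lambda>v c. c v) \<in> borel_measurable (Pi\<^sub>M UNIV (\<lambda>_. Pi\<^sub>M UNIV (\<lambda>_. borel)))"
proof -
  note [measurable] = brw_W_coordinates_measurable
  show ?thesis unfolding brw_Wlim_def by measurable
qed

lemma brw_Wlim_eq_coordinates: "brw_Wlim \<xi>' \<omega> = brw_Wlim (\<lambda>v c. c v) (\<lambda>v. \<xi>' v \<omega>)"
  unfolding brw_Wlim_def by (subst brw_W_eq_coordinates) simp

lemma pcount_corner_eq_card:
  assumes "\<omega> \<in> space M" and k: "pcount (\<xi> [] \<omega>) (corner u) = of_nat k"
  shows "finite {i. level (\<xi> [] \<omega> i) \<le> u}" "card {i. level (\<xi> [] \<omega> i) \<le> u} = k"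
proof -
  have *: "emeasure (count_space UNIV) {i. level (\<xi> [] \<omega> i) \<le> u} = of_nat k"
    using k root.in_corner_iff[OF assms(1)] by (simp add: pcount_def)
  show "finite {i. level (\<xi> [] \<omega> i) \<le> u}"
  proof (rule ccontr)
    assume "infinite {i. level (\<xi> [] \<omega> i) \<le> u}"
    then have "of_nat k = (top :: ennreal)" using * by simp
    then show False using of_nat_less_top[of k] by (metis less_irrefl)
  qed
  with * show "card {i. level (\<xi> [] \<omega> i) \<le> u} = k" by simp
qed

text \<open>The event forces the limit of every subtree rooted at level at most \<open>u\<close> to
  lie below \<delta>. Given the set \<open>J\<close> of these children, independence bounds the
  probability by \<open>q ^ card J\<close>, and averaging over the Poisson number of such children
  yields its generating function at \<open>q\<close>.\<close>

lemma prob_brw_Wlim_less_exp: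
  assumes q: "\<And>i. prob {\<omega>\<in>space M. brw_Wlim (subtree i \<xi>) \<omega> < ennreal \<delta>} \<le> q"
    and "0 \<le> \<delta>" "0 \<le> u"
  shows "prob {\<omega>\<in>space M. brw_Wlim \<xi> \<omega> < ennreal (\<delta> * exp (- u))} \<le> exp (- ((1 - q) * (u\<^sup>2 / 2)))"
proof -
  interpret sub: poisson_brw M "subtree i \<xi>" for i by (rule poisson_brw_subtree)
  have q0: "0 \<le> q" using q[of 0] measure_nonneg order_trans by blast
  let ?I = "{J :: nat set. finite J}"
  define R where "R J z = (of_bool (\<forall>i. level (z i) \<le> u \<longleftrightarrow> i \<in> J) :: ennreal)" for J and z :: "nat \<Rightarrow> real \<times> real"
  define H where "H c = (of_bool (brw_Wlim (\<lambda>v c. c v) c < ennreal \<delta>) :: ennreal)" for c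
  \<comment> \<open>An extension of \<open>k \<mapsto> q ^ k\<close> to all of
    \<open>ennreal\<close>, since counts take values there.\<close>
  define f where "f x = ennreal q ^ nat \<lfloor>enn2real x\<rfloor>" for x
  have f_of_nat: "f (of_nat k) = ennreal (q ^ k)" for k
    using q0 by (simp add: f_def ennreal_power)
  have R_meas [measurable]: "R J \<in> borel_measurable (Pi\<^sub>M UNIV (\<lambda>_. borel))" for J
    unfolding R_def[abs_def] by measurable
  have H_meas: "H \<in> borel_measurable (Pi\<^sub>M UNIV (\<lambda>_. Pi\<^sub>M UNIV (\<lambda>_. borel)))"
  proof -
    note [measurable] = brw_Wlim_coordinates_measurable
    show ?thesis unfolding H_def[abs_def] by measurable
  qed
  have R_M [measurable]: "(\<lambda>\<omega>. R J (\<xi> [] \<omega>)) \<in> borel_measurable M" for J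
    unfolding R_def by measurable
  have H_sub: "H (\<lambda>v. subtree i \<xi> v \<omega>) = of_bool (brw_Wlim (subtree i \<xi>) \<omega> < ennreal \<delta>)" for i \<omega>
    unfolding H_def brw_Wlim_eq_coordinates[of "subtree i \<xi>"] ..
  have H_M [measurable]: "(\<lambda>\<omega>. H (\<lambda>v. subtree i \<xi> v \<omega>)) \<in> borel_measurable M" for i
    unfolding H_sub by measurable
  have H_prob: "(\<integral>\<^sup>+\<omega>. H (\<lambda>v. subtree i \<xi> v \<omega>) \<partial>M) \<le> ennreal q" for i
  proof -
    have "(\<integral>\<^sup>+\<omega>. H (\<lambda>v. subtree i \<xi> v \<omega>) \<partial>M)
      = (\<integral>\<^sup>+\<omega>. indicator {\<omega>\<in>space M. brw_Wlim (subtree i \<xi>) \<omega> < ennreal \<delta>} \<omega> \<partial>M)"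
      unfolding H_sub by (intro nn_integral_cong) (simp add: indicator_def)
    also have "\<dots> = ennreal (prob {\<omega>\<in>space M. brw_Wlim (subtree i \<xi>) \<omega> < ennreal \<delta>})"
      by (simp add: emeasure_eq_measure)
    finally show ?thesis using q by (simp add: ennreal_leI)
  qed
  have countable: "countable ?I" by (rule countable_Collect_finite)
  have finite_AE: "AE \<omega> in M. \<omega> \<in> space M \<and> finite {i. level (\<xi> [] \<omega> i) \<le> u} \<and>
      pcount (\<xi> [] \<omega>) (corner u) = of_nat (card {i. level (\<xi> [] \<omega> i) \<le> u})"
    using root.AE_pcount_nat[OF finite_area_corner[of u]] AE_space
  proof eventually_elim
    case (elim \<omega>)
    then obtain k :: nat where "pcount (\<xi> [] \<omega>) (corner u) = of_nat k" by auto
    with pcount_corner_eq_card[OF _ this] elim show ?case by simp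
  qed
  have "emeasure M {\<omega>\<in>space M. brw_Wlim \<xi> \<omega> < ennreal (\<delta> * exp (- u))}
    = (\<integral>\<^sup>+\<omega>. indicator {\<omega>\<in>space M. brw_Wlim \<xi> \<omega> < ennreal (\<delta> * exp (- u))} \<omega> \<partial>M)"
    by simp
  \<comment> \<open>The random set of low children is replaced by a sum over all finite
    \<open>J\<close>. On the event, the term of the actual set equals 1, and there are countably
    many \<open>J\<close>, so sum and expectation can be exchanged.\<close>
  also have "\<dots> \<le> (\<integral>\<^sup>+\<omega>. \<integral>\<^sup>+J. R J (\<xi> [] \<omega>) * (\<Prod>i\<in>J. H (\<lambda>v. subtree i \<xi> v \<omega>)) \<partial>count_space ?I \<partial>M)"
  proof (rule nn_integral_mono_AE)
    show "AE \<omega> in M. indicator {\<omega>\<in>space M. brw_Wlim \<xi> \<omega> < ennreal (\<delta> * exp (- u))} \<omega>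
      \<le> (\<integral>\<^sup>+J. R J (\<xi> [] \<omega>) * (\<Prod>i\<in>J. H (\<lambda>v. subtree i \<xi> v \<omega>)) \<partial>count_space ?I)"
      using finite_AE
    proof eventually_elim
      case (elim \<omega>)
      let ?S = "{i. level (\<xi> [] \<omega> i) \<le> u}"
      show ?case
      proof (cases "brw_Wlim \<xi> \<omega> < ennreal (\<delta> * exp (- u))")
        case True
        have "brw_Wlim (subtree i \<xi>) \<omega> < ennreal \<delta>" if "i \<in> ?S" for i
        proof (rule ccontr)
          assume "\<not> brw_Wlim (subtree i \<xi>) \<omega> < ennreal \<delta>"
          then have "ennreal (exp (- u)) * ennreal \<delta> \<le> ennreal (exp (- level (\<xi> [] \<omega> i))) * brw_Wlim (subtree i \<xi>) \<omega>"
            using that by (intro mult_mono ennreal_leI) auto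
          also have "\<dots> \<le> brw_Wlim \<xi> \<omega>" by (rule brw_Wlim_ge_child)
          finally show False using True \<open>0 \<le> \<delta>\<close> by (simp add: ennreal_mult[symmetric] mult.commute)
        qed
        then have "R ?S (\<xi> [] \<omega>) * (\<Prod>i\<in>?S. H (\<lambda>v. subtree i \<xi> v \<omega>)) = 1"
          by (simp add: R_def H_sub)
        then have "indicator {\<omega>\<in>space M. brw_Wlim \<xi> \<omega> < ennreal (\<delta> * exp (- u))} \<omega>
          \<le> R ?S (\<xi> [] \<omega>) * (\<Prod>i\<in>?S. H (\<lambda>v. subtree i \<xi> v \<omega>))"
          by (simp add: indicator_def)
        also have "\<dots> \<le> (\<integral>\<^sup>+J. R J (\<xi> [] \<omega>) * (\<Prod>i\<in>J. H (\<lambda>v. subtree i \<xi> v \<omega>)) \<partial>count_space ?I)"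
          using elim by (intro nn_integral_ge_point) auto
        finally show ?thesis .
      qed simp
    qed
  qed
  also have "\<dots> = (\<integral>\<^sup>+J. \<integral>\<^sup>+\<omega>. R J (\<xi> [] \<omega>) * (\<Prod>i\<in>J. H (\<lambda>v. subtree i \<xi> v \<omega>)) \<partial>M \<partial>count_space ?I)"
    by (rule nn_integral_count_space_nn_integral[OF countable]) measurable
  also have "\<dots> \<le> (\<integral>\<^sup>+J. \<integral>\<^sup>+\<omega>. R J (\<xi> [] \<omega>) * ennreal q ^ card J \<partial>M \<partial>count_space ?I)"
  proof (rule nn_integral_mono)
    fix J assume "J \<in> space (count_space ?I)"
    then have "(\<integral>\<^sup>+\<omega>. R J (\<xi> [] \<omega>) * (\<Prod>i\<in>J. H (\<lambda>v. subtree i \<xi> v \<omega>)) \<partial>M)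
      = (\<integral>\<^sup>+\<omega>. R J (\<xi> [] \<omega>) \<partial>M) * (\<Prod>i\<in>J. \<integral>\<^sup>+\<omega>. H (\<lambda>v. subtree i \<xi> v \<omega>) \<partial>M)"
      by (intro nn_integral_root_subtrees[where H="\<lambda>_. H"] R_meas H_meas) simp
    also have "\<dots> \<le> (\<integral>\<^sup>+\<omega>. R J (\<xi> [] \<omega>) \<partial>M) * ennreal q ^ card J"
      using \<open>J \<in> space (count_space ?I)\<close> by (intro mult_left_mono prod_ennreal_le_power H_prob) auto
    finally show "(\<integral>\<^sup>+\<omega>. R J (\<xi> [] \<omega>) * (\<Prod>i\<in>J. H (\<lambda>v. subtree i \<xi> v \<omega>)) \<partial>M)
      \<le> (\<integral>\<^sup>+\<omega>. R J (\<xi> [] \<omega>) * ennreal q ^ card J \<partial>M)"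
      by (simp add: nn_integral_multc)
  qed
  also have "\<dots> = (\<integral>\<^sup>+\<omega>. \<integral>\<^sup>+J. R J (\<xi> [] \<omega>) * ennreal q ^ card J \<partial>count_space ?I \<partial>M)"
    by (rule nn_integral_count_space_nn_integral[OF countable, symmetric]) measurable
  \<comment> \<open>Almost surely exactly one \<open>J\<close> agrees with the set of low children,
    and its cardinality is the count in the corner.\<close>
  also have "\<dots> = (\<integral>\<^sup>+\<omega>. f (pcount (\<xi> [] \<omega>) (corner u)) \<partial>M)"
  proof (rule nn_integral_cong_AE)
    show "AE \<omega> in M. (\<integral>\<^sup>+J. R J (\<xi> [] \<omega>) * ennreal q ^ card J \<partial>count_space ?I)
      = f (pcount (\<xi> [] \<omega>) (corner u))"
      using finite_AE
    proof eventually_elim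
      case (elim \<omega>)
      let ?S = "{i. level (\<xi> [] \<omega> i) \<le> u}"
      have "(\<integral>\<^sup>+J. R J (\<xi> [] \<omega>) * ennreal q ^ card J \<partial>count_space ?I)
        = (\<Sum>J\<in>{?S}. R J (\<xi> [] \<omega>) * ennreal q ^ card J)"
        using elim by (intro nn_integral_count_space') (auto simp: R_def)
      also have "\<dots> = ennreal q ^ card ?S"
        by (simp add: R_def)
      also have "\<dots> = f (pcount (\<xi> [] \<omega>) (corner u))"
        using elim q0 f_of_nat by (simp add: ennreal_power)
      finally show ?case .
    qed
  qed
  also have "\<dots> = (\<Sum>k. ennreal (q ^ k) * ennreal (exp (- (u\<^sup>2 / 2)) * (u\<^sup>2 / 2) ^ k / fact k))"
    using \<open>0 \<le> u\<close> by (simp add: root.nn_integral_pcount[OF finite_area_corner] f_of_nat measure_corner)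
  also have "\<dots> = (\<Sum>k. ennreal (exp (- (u\<^sup>2 / 2)) * ((q * (u\<^sup>2 / 2)) ^ k /\<^sub>R fact k)))"
  proof (rule suminf_cong)
    fix k
    have "q ^ k * (e * m ^ k / fact k) = e * ((q * m) ^ k /\<^sub>R fact k)" for e m :: real
      by (simp only: power_mult_distrib divide_inverse scaleR_conv_of_real of_real_inverse of_real_fact mult_ac)
    then show "ennreal (q ^ k) * ennreal (exp (- (u\<^sup>2 / 2)) * (u\<^sup>2 / 2) ^ k / fact k)
      = ennreal (exp (- (u\<^sup>2 / 2)) * ((q * (u\<^sup>2 / 2)) ^ k /\<^sub>R fact k))"
      using q0 by (subst ennreal_mult[symmetric]) (simp_all only: zero_le_power, simp)
  qed
  also have "\<dots> = ennreal (exp (- (u\<^sup>2 / 2)) * exp (q * (u\<^sup>2 / 2)))"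
    using q0 by (intro suminf_ennreal_eq sums_mult exp_converges) auto
  also have "exp (- (u\<^sup>2 / 2)) * exp (q * (u\<^sup>2 / 2)) = exp (- ((1 - q) * (u\<^sup>2 / 2)))"
    by (simp add: exp_add[symmetric] field_simps)
  finally show ?thesis by (simp add: emeasure_eq_measure)
qed

text \<open>Markov's inequality on the void event, with Fatou's lemma carrying the constant mean
  over to the limit. The part of the void event where the limit is at least \<open>x\<close> has
  probability at most that mean divided by \<open>x\<close>; the rest lies in the desired
  event.\<close>

lemma prob_brw_Wlim_less_ge:
  assumes "0 \<le> u" "0 < x"
  shows "exp (- (u\<^sup>2 / 2)) * (1 - exp (- u) * (u + 1) / x) \<le> prob {\<omega>\<in>space M. brw_Wlim \<xi> \<omega> < ennreal x}"
proof -
  let ?v = "\<lambda>\<omega>. indicator {0} (pcount (\<xi> [] \<omega>) (corner u)) :: ennreal"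
  let ?b = "exp (- (u\<^sup>2 / 2)) * (exp (- u) * (u + 1))"
  let ?V = "{\<omega>\<in>space M. pcount (\<xi> [] \<omega>) (corner u) = 0}"
  let ?L = "{\<omega>\<in>space M. brw_Wlim \<xi> \<omega> < ennreal x}"
  let ?B = "{\<omega>\<in>space M. pcount (\<xi> [] \<omega>) (corner u) = 0 \<and> ennreal x \<le> brw_Wlim \<xi> \<omega>}"
  have "ennreal x * emeasure M ?B = (\<integral>\<^sup>+\<omega>. ennreal x * indicator ?B \<omega> \<partial>M)"
    by (subst nn_integral_cmult_indicator) auto
  also have "\<dots> \<le> (\<integral>\<^sup>+\<omega>. liminf (\<lambda>n. ?v \<omega> * brw_W \<xi> (Suc n) \<omega>) \<partial>M)"
  proof (rule nn_integral_mono)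
    fix \<omega>
    have "brw_Wlim \<xi> \<omega> = liminf (\<lambda>n. brw_W \<xi> (Suc n) \<omega>)"
      unfolding brw_Wlim_def using liminf_shift[of "\<lambda>n. brw_W \<xi> n \<omega>"] by simp
    then show "ennreal x * indicator ?B \<omega> \<le> liminf (\<lambda>n. ?v \<omega> * brw_W \<xi> (Suc n) \<omega>)"
      by (auto simp: indicator_def)
  qed
  also have "\<dots> \<le> liminf (\<lambda>n. \<integral>\<^sup>+\<omega>. ?v \<omega> * brw_W \<xi> (Suc n) \<omega> \<partial>M)"
    by (rule nn_integral_liminf) measurable
  also have "\<dots> = ennreal ?b"
    using assms(1) by (simp add: nn_integral_void_brw_W_Suc nn_integral_brw_W[OF poisson_brw_subtree]
        Liminf_const ennreal_mult)
  finally have "ennreal (x * prob ?B) \<le> ennreal ?b"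
    using assms(2) by (simp add: emeasure_eq_measure ennreal_mult)
  then have "x * prob ?B \<le> ?b"
    using assms(1) by (subst (asm) ennreal_le_iff) auto
  then have "prob ?B \<le> ?b / x"
    using assms(2) by (simp add: field_simps)
  moreover have "prob ?V = exp (- (u\<^sup>2 / 2))"
    using root.prob_pcount[OF finite_area_corner, of u 0] assms(1) by (simp add: measure_corner)
  moreover have "prob ?V \<le> prob ?L + prob ?B"
    by (rule order_trans[OF finite_measure_mono measure_Un_le]) auto
  ultimately show ?thesis by (simp add: algebra_simps)
qed

end

text \<open>The first application of the small ball bound, with \<delta> = 1/8 and
  \<open>q = 31 / 32\<close>. The new \<delta> is chosen before \<xi>, so that it serves all
  subtrees simultaneously in the second application.\<close>

lemma prob_brw_Wlim_less_small:
  assumes "0 < \<epsilon>"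
  obtains \<delta> where "0 < \<delta>"
    "\<And>\<xi>. poisson_brw M \<xi> \<Longrightarrow> measure M {\<omega>\<in>space M. brw_Wlim \<xi> \<omega> < ennreal \<delta>} \<le> \<epsilon>"
proof -
  have "((\<lambda>u::real. exp (- ((1 - 31 / 32) * (u\<^sup>2 / 2)))) \<longlongrightarrow> 0) at_top"
    by real_asymp
  then have "eventually (\<lambda>u::real. exp (- ((1 - 31 / 32) * (u\<^sup>2 / 2))) < \<epsilon> \<and> 0 \<le> u) at_top"
    using assms by (intro eventually_conj order_tendstoD(2) eventually_ge_at_top)
  then obtain u :: real where u: "exp (- ((1 - 31 / 32) * (u\<^sup>2 / 2))) < \<epsilon>" "0 \<le> u"
    by (auto dest: eventually_happens)
  show ?thesis
  proof (rule that[of "1 / 8 * exp (- u)"])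
    fix \<xi> :: "nat list \<Rightarrow> 'a \<Rightarrow> nat \<Rightarrow> real \<times> real" assume "poisson_brw M \<xi>"
    then interpret poisson_brw M \<xi> .
    have "prob {\<omega>\<in>space M. brw_Wlim \<xi> \<omega> < ennreal (1 / 8 * exp (- u))} \<le> exp (- ((1 - 31 / 32) * (u\<^sup>2 / 2)))"
      by (intro prob_brw_Wlim_less_exp u poisson_brw.prob_brw_Wlim_small poisson_brw_subtree) simp
    with u show "prob {\<omega>\<in>space M. brw_Wlim \<xi> \<omega> < ennreal (1 / 8 * exp (- u))} \<le> \<epsilon>" by linarith
  qed simp
qed

section \<open>Asymptotics of the logarithm of the left tail\<close>

context poisson_brw
begin

text \<open>The choice \<open>u = - ln x + sqrt (- ln x)\<close> makes the Markov error
  \<open>exp (- sqrt (- ln x)) * (u + 1)\<close>, which tends to 0, while the excess over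
  \<open>- ln x\<close> is of lower order. An error below 1/2 costs the term \<open>ln 2\<close>.
  Positivity is recorded for later comparisons of logarithms.\<close>

lemma ln_prob_brw_Wlim_upper:
  "eventually (\<lambda>x. 0 < prob {\<omega>\<in>space M. brw_Wlim \<xi> \<omega> < ennreal x} \<and>
     - ln (prob {\<omega>\<in>space M. brw_Wlim \<xi> \<omega> < ennreal x}) \<le> (- ln x + sqrt (- ln x))\<^sup>2 / 2 + ln 2) (at_right 0)"
proof -
  have "((\<lambda>x::real. exp (- sqrt (- ln x)) * (- ln x + sqrt (- ln x) + 1)) \<longlongrightarrow> 0) (at_right 0)"
    by real_asymp
  then have "eventually (\<lambda>x::real. exp (- sqrt (- ln x)) * (- ln x + sqrt (- ln x) + 1) < 1 / 2) (at_right 0)"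
    by (rule order_tendstoD) simp
  moreover have "eventually (\<lambda>x::real. x \<in> {0<..<1}) (at_right 0)"
    by (rule eventually_at_right_real) simp
  ultimately show ?thesis
  proof eventually_elim
    case (elim x)
    let ?u = "- ln x + sqrt (- ln x)" and ?p = "prob {\<omega>\<in>space M. brw_Wlim \<xi> \<omega> < ennreal x}"
    have u: "0 \<le> ?u" using elim by (intro add_nonneg_nonneg) auto
    have "exp (- ?u) / x = exp (- sqrt (- ln x))"
      using elim by (simp add: exp_diff exp_minus field_simps)
    then have "exp (- ?u) * (?u + 1) / x = exp (- sqrt (- ln x)) * (?u + 1)"
      by (metis times_divide_eq_left)
    then have half: "1 / 2 \<le> 1 - exp (- ?u) * (?u + 1) / x"
      using elim by (simp add: add.assoc)
    have "exp (- (?u\<^sup>2 / 2)) * (1 / 2) \<le> exp (- (?u\<^sup>2 / 2)) * (1 - exp (- ?u) * (?u + 1) / x)"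
      by (intro mult_left_mono half) simp
    also have "\<dots> \<le> ?p"
      using u elim by (intro prob_brw_Wlim_less_ge) auto
    finally have p: "exp (- (?u\<^sup>2 / 2)) * (1 / 2) \<le> ?p" .
    moreover have "0 < exp (- (?u\<^sup>2 / 2)) * (1 / 2)" by simp
    ultimately have "0 < ?p" by linarith
    moreover have "ln (exp (- (?u\<^sup>2 / 2)) * (1 / 2)) \<le> ln ?p"
      using p \<open>0 < ?p\<close> by (subst ln_le_cancel_iff) auto
    then have "- ln ?p \<le> ?u\<^sup>2 / 2 + ln 2"
      by (subst (asm) ln_mult) (auto simp: ln_div)
    ultimately show ?case by simp
  qed
qed

text \<open>The second application of the small ball bound, now with \<open>q\<close> equal to the
  given \<epsilon>. The preceding upper estimate enters through the positivity of the
  probability.\<close>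

lemma ln_prob_brw_Wlim_lower:
  assumes "0 < \<epsilon>"
  obtains c where "eventually (\<lambda>x. (1 - \<epsilon>) * ((c - ln x)\<^sup>2 / 2)
     \<le> - ln (prob {\<omega>\<in>space M. brw_Wlim \<xi> \<omega> < ennreal x})) (at_right 0)"
proof -
  from prob_brw_Wlim_less_small[OF assms, of M] obtain \<delta> where \<delta>: "0 < \<delta>"
    "\<And>\<xi>. poisson_brw M \<xi> \<Longrightarrow> prob {\<omega>\<in>space M. brw_Wlim \<xi> \<omega> < ennreal \<delta>} \<le> \<epsilon>"
    by blast
  have "eventually (\<lambda>x::real. x \<in> {0<..<\<delta>}) (at_right 0)"
    by (rule eventually_at_right_real) fact
  with ln_prob_brw_Wlim_upper
  have "eventually (\<lambda>x. (1 - \<epsilon>) * ((ln \<delta> - ln x)\<^sup>2 / 2)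
     \<le> - ln (prob {\<omega>\<in>space M. brw_Wlim \<xi> \<omega> < ennreal x})) (at_right 0)"
  proof eventually_elim
    case (elim x)
    let ?p = "prob {\<omega>\<in>space M. brw_Wlim \<xi> \<omega> < ennreal x}"
    \<comment> \<open>This determines the level \<open>u = ln \<delta> - ln x\<close>, which is
      positive because \<open>x < \<delta>\<close>.\<close>
    have x: "\<delta> * exp (- (ln \<delta> - ln x)) = x"
      using elim \<delta>(1) by (simp add: exp_diff)
    have "prob {\<omega>\<in>space M. brw_Wlim \<xi> \<omega> < ennreal (\<delta> * exp (- (ln \<delta> - ln x)))}
        \<le> exp (- ((1 - \<epsilon>) * ((ln \<delta> - ln x)\<^sup>2 / 2)))"
      using elim \<delta>(1) by (intro prob_brw_Wlim_less_exp \<delta>(2) poisson_brw_subtree) auto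
    then have "?p \<le> exp (- ((1 - \<epsilon>) * ((ln \<delta> - ln x)\<^sup>2 / 2)))"
      unfolding x .
    then have "ln ?p \<le> ln (exp (- ((1 - \<epsilon>) * ((ln \<delta> - ln x)\<^sup>2 / 2))))"
      using elim by (subst ln_le_cancel_iff) auto
    then show ?case by simp
  qed
  then show ?thesis by (rule that)
qed

text \<open>The shift by \<open>c\<close> and the corrections of order \<open>sqrt (- ln x)\<close>
  and \<open>ln 2\<close> disappear after division by \<open>(ln x)\<^sup>2 / 2\<close>, so the
  ratio is eventually above every \<open>a < 1\<close> and below every \<open>a > 1\<close>.\<close>

lemma ln_prob_brw_Wlim_asymp:
  "(\<lambda>x. - ln (prob {\<omega>\<in>space M. brw_Wlim \<xi> \<omega> < ennreal x})) \<sim>[at_right 0] (\<lambda>x. (ln x)\<^sup>2 / 2)"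
proof (rule asymp_equivI', rule order_tendstoI)
  let ?p = "\<lambda>x. prob {\<omega>\<in>space M. brw_Wlim \<xi> \<omega> < ennreal x}"
  have unit: "eventually (\<lambda>x::real. x \<in> {0<..<1}) (at_right 0)"
    by (rule eventually_at_right_real) simp
  fix a :: real
  {
    assume "a < 1"
    \<comment> \<open>With this choice \<open>1 - \<epsilon>\<close> is the midpoint of
      \<open>a\<close> and 1, hence strictly above \<open>a\<close>.\<close>
    define \<epsilon> where "\<epsilon> = (1 - a) / 2"
    have \<epsilon>: "0 < \<epsilon>" "a < (1 - \<epsilon>) * 1" using \<open>a < 1\<close> by (auto simp: \<epsilon>_def field_simps)
    obtain c where c: "eventually (\<lambda>x. (1 - \<epsilon>) * ((c - ln x)\<^sup>2 / 2) \<le> - ln (?p x)) (at_right 0)"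
      using ln_prob_brw_Wlim_lower[OF \<epsilon>(1)] by blast
    have "((\<lambda>x. (c - ln x)\<^sup>2 / (ln x)\<^sup>2) \<longlongrightarrow> 1) (at_right 0)"
      by real_asymp
    then have "((\<lambda>x. (1 - \<epsilon>) * ((c - ln x)\<^sup>2 / (ln x)\<^sup>2)) \<longlongrightarrow> (1 - \<epsilon>) * 1) (at_right 0)"
      by (intro tendsto_intros)
    then have "eventually (\<lambda>x. a < (1 - \<epsilon>) * ((c - ln x)\<^sup>2 / (ln x)\<^sup>2)) (at_right 0)"
      using \<epsilon>(2) by (rule order_tendstoD)
    with c unit show "eventually (\<lambda>x. a < - ln (?p x) / ((ln x)\<^sup>2 / 2)) (at_right 0)"
    proof eventually_elim
      case (elim x)
      have "0 < (ln x)\<^sup>2 / 2" using elim by simp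
      have "(1 - \<epsilon>) * ((c - ln x)\<^sup>2 / (ln x)\<^sup>2) = ((1 - \<epsilon>) * ((c - ln x)\<^sup>2 / 2)) / ((ln x)\<^sup>2 / 2)"
        by simp
      also have "\<dots> \<le> - ln (?p x) / ((ln x)\<^sup>2 / 2)"
        using elim \<open>0 < (ln x)\<^sup>2 / 2\<close> by (intro divide_right_mono) auto
      finally show ?case using elim by linarith
    qed
  next
    assume "1 < a"
    have "((\<lambda>x::real. ((- ln x + sqrt (- ln x))\<^sup>2 / 2 + ln 2) / ((ln x)\<^sup>2 / 2)) \<longlongrightarrow> 1) (at_right 0)"
      by real_asymp
    then have "eventually (\<lambda>x::real. ((- ln x + sqrt (- ln x))\<^sup>2 / 2 + ln 2) / ((ln x)\<^sup>2 / 2) < a) (at_right 0)"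
      using \<open>1 < a\<close> by (rule order_tendstoD)
    with ln_prob_brw_Wlim_upper unit show "eventually (\<lambda>x. - ln (?p x) / ((ln x)\<^sup>2 / 2) < a) (at_right 0)"
    proof eventually_elim
      case (elim x)
      then have "- ln (?p x) / ((ln x)\<^sup>2 / 2) \<le> ((- ln x + sqrt (- ln x))\<^sup>2 / 2 + ln 2) / ((ln x)\<^sup>2 / 2)"
        by (intro divide_right_mono) auto
      with elim show ?case by linarith
    qed
  }
qed

end

theorem theorem1p1:
  fixes M :: "'a measure" and \<xi> :: "nat list \<Rightarrow> 'a \<Rightarrow> nat \<Rightarrow> real \<times> real"
  assumes "prob_space M"
    and "\<And>v. poisson_pp M (\<xi> v)"
    and "prob_space.indep_vars M (\<lambda>_. Pi\<^sub>M UNIV (\<lambda>_. borel)) \<xi> UNIV"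
  shows "(\<lambda>x. - ln (measure M {\<omega>\<in>space M. brw_Wlim \<xi> \<omega> < ennreal x}))
           \<sim>[at_right 0] (\<lambda>x. (ln x)\<^sup>2 / 2)"
proof -
  interpret poisson_brw M \<xi>
    using assms by (simp add: poisson_brw_def poisson_brw_axioms_def)
  show ?thesis by (rule ln_prob_brw_Wlim_asymp)
qed

end
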